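(* Let $\alpha$ be a Diophantine frequency and consider the family of QPF quadratic polynomials $$Q_\lambda(\theta,z)=\big(\theta+\alpha,\ z^2+\lambda(\theta)z\big),\qquad (\theta,z)\in\mathbb{T}^1\times\mathbb{C}.$$ Then the fibered multiplier map $$\widehat{\kappa}:\mathcal{H}_0^*(\mathbb{T}^1)\to\mathbb{D}^*,\qquad \widehat{\kappa}(\lambda)=\exp\left(\int_{\mathbb{T}^1}\log\lambda(\theta)\,d\theta\right),$$ is a holomorphic submersion.
   Context: $\mathbb{T}^1=\mathbb{R}/\mathbb{Z}$; $\mathbb{D}$ is the open unit disk, $\mathbb{D}^*=\mathbb{D}\setminus\{0\}$. The number $\alpha\in\mathbb{R}\setminus\mathbb{Q}$ is Diophantine if there are $\delta>0$ and $\tau\ge2$ with $|\alpha-p/q|>\delta/|q|^\tau$ for all rationals $p/q$. $\mathcal{C}(\mathbb{T}^1)$ is the complex Banach space of continuous functions $\mathbb{T}^1\to\mathbb{C}$ with the sup-norm, and $\mathcal{C}^*(\mathbb{T}^1)$ is its open subset of nowhere-vanishing functions. For $\lambda\in\mathcal{C}(\mathbb{T}^1)$ put $q_{\lambda,\theta}(z)=z^2+\lambda(\theta)z$ and $q_{\lambda,\theta}^n=q_{\lambda,\theta+(n-1)\alpha}\circ\cdots\circ q_{\lambda,\theta}$. The fibered filled-in Julia set of $Q_\lambda$ is $\mathcal{K}_\lambda=\{(\theta,z)\in\mathbb{T}^1\times\mathbb{C}:\sup_n|q_{\lambda,\theta}^n(z)|<\infty\}$, with fibers $\mathcal{K}_{\lambda,\theta}=\{z:(\theta,z)\in\mathcal{K}_\lambda\}$,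 and its fibered Julia set is $\mathcal{J}_\lambda=\overline{\bigsqcup_{\theta}\{\theta\}\times\partial\mathcal{K}_{\lambda,\theta}}$. $Q_\lambda$ is hyperbolic if there are $A>0$ and $\sigma>1$ such that $|(q_{\lambda,\theta}^n)'(z)|\ge A\sigma^n$ for all $(\theta,z)\in\mathcal{J}_\lambda$ and $n\in\mathbb{N}$. The connectedness locus $\mathcal{M}(\mathbb{T}^1)\subset\mathcal{C}(\mathbb{T}^1)$ is the set of $\lambda$ such that $\mathcal{K}_{\lambda,\theta}$ is connected for all $\theta$. The generalized main cardioid $\mathcal{M}_0(\mathbb{T}^1)\subset\mathcal{M}(\mathbb{T}^1)$ is the set of those $\lambda\in\mathcal{M}(\mathbb{T}^1)$ for which $Q_\lambda$ is hyperbolic and the interior of $\mathcal{K}_{\lambda,\theta}$ is connected and non-empty for every $\theta\in\mathbb{T}^1$; it is known (Sester) to be open in $\mathcal{C}(\mathbb{T}^1)$. Let $\mathcal{M}_0^*(\mathbb{T}^1)=\mathcal{M}_0(\mathbb{T}^1)\cap\mathcal{C}^*(\mathbb{T}^1)$ and $$\mathcal{H}_0^*(\mathbb{T}^1)=\left\{\lambda\in\mathcal{M}_0^*(\mathbb{T}^1):\ \int_{\mathbb{T}^1}\log|\lambda(\theta)|\,d\theta<0\ \text{ and }\ \mathrm{wind}(\lambda,0)=0\right\},$$ where $\mathrm{wind}(\lambda,0)$ is the winding number of the closed curve $\theta\mapsto\lambda(\theta)$ about $0$. The set $\mathcal{H}_0^*(\mathbb{T}^1)$ is open in $\mathcal{C}(\mathbb{T}^1)$,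 hence a complex Banach manifold. For $\lambda\in\mathcal{H}_0^*(\mathbb{T}^1)$, $Q_\lambda$ has $\gamma\equiv0$ as its unique attracting invariant curve. In the formula for $\widehat\kappa$, $\log\lambda(\theta)$ is any continuous branch of the logarithm along $\mathbb{T}^1$ (it exists since the winding number is zero; $\widehat\kappa(\lambda)$ does not depend on the choice). A map $F:U\to N$ from an open subset $U$ of a complex Banach space $M$ to a complex Banach space $N$ is holomorphic if it is continuously (Fréchet) differentiable with complex-linear bounded derivative; this extends to complex Banach manifolds via charts. A holomorphic map $F:\mathcal{M}\to\mathcal{N}$ of complex Banach manifolds is a holomorphic submersion if for each $x\in\mathcal{M}$ there are charts $(U,\varphi)$ at $x$ and $(V,\psi)$ at $F(x)$ such that $\varphi$ is a biholomorphism of $U$ onto a product $U_1\times U_2$ of open subsets of Banach spaces and $\psi\circ F\circ\varphi^{-1}$ is the projection onto the first factor followed by a biholomorphism of $U_1$ onto an open set. Equivalently, for each $x\in\mathcal{M}$ there are a neighborhood $\mathcal{V}$ of $F(x)$ and a holomorphic map $s:\mathcal{V}\to\mathcal{M}$ with $s(F(x))=x$ and $F\circ s=\mathrm{Id}_{\mathcal{V}}$. *)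

theory Defs
  imports "HOL-Complex_Analysis.Complex_Analysis"
begin

section \<open>The circle as the quotient of the real line by the integers\<close>

quotient_type circle = real / "\<lambda>x y :: real. x - y \<in> \<int>"
  morphisms rep_circle circle_of
proof (intro equivpI reflpI sympI transpI)
  fix x y z :: real
  show "x - x \<in> \<int>" by simp
  show "y - x \<in> \<int>" if "x - y \<in> \<int>"
    using Ints_minus[OF that] by simp
  show "x - z \<in> \<int>" if "x - y \<in> \<int>" "y - z \<in> \<int>"
    using Ints_add[OF that] by simp
qed

instantiation circle :: ab_group_add
begin

lift_definition zero_circle :: circle is "0 :: real" .

lift_definition plus_circle :: "circle \<Rightarrow> circle \<Rightarrow> circle" is "(+) :: real \<Rightarrow> real \<Rightarrow> real"
  by (metis Ints_add add_diff_add)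

lift_definition uminus_circle :: "circle \<Rightarrow> circle" is "uminus :: real \<Rightarrow> real"
  by (metis Ints_minus minus_diff_minus)

lift_definition minus_circle :: "circle \<Rightarrow> circle \<Rightarrow> circle" is "(-) :: real \<Rightarrow> real \<Rightarrow> real"
  by (metis Ints_diff diff_diff_eq2 diff_diff_eq add_diff_eq diff_add_eq)

instance
  by standard (transfer; simp)+

end

lemma round_dist_cong:
  fixes u v :: real
  assumes "u - v \<in> \<int>"
  shows "\<bar>u - of_int (round u)\<bar> = \<bar>v - of_int (round v)\<bar>"
proof -
  obtain k where k: "u = v + of_int k"
    using assms by (metis Ints_cases add.commute diff_add_cancel)
  have "\<bar>u - of_int (round u)\<bar> \<le> \<bar>u - of_int (round v + k)\<bar>"
    by (rule round_diff_minimal)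
  moreover have "\<bar>v - of_int (round v)\<bar> \<le> \<bar>v - of_int (round u - k)\<bar>"
    by (rule round_diff_minimal)
  ultimately show ?thesis
    by (simp add: k algebra_simps)
qed

text \<open>The quotient metric: the distance of a difference to the nearest integer.\<close>

instantiation circle :: metric_space
begin

lift_definition dist_circle :: "circle \<Rightarrow> circle \<Rightarrow> real"
  is "\<lambda>x y. \<bar>(x - y) - of_int (round (x - y))\<bar>"
proof -
  fix x x' y y' :: real
  assume "x - x' \<in> \<int>" "y - y' \<in> \<int>"
  then have "(x - y) - (x' - y') \<in> \<int>"
    using Ints_diff[of "x - x'" "y - y'"] by (simp add: algebra_simps)
  then show "\<bar>(x - y) - of_int (round (x - y))\<bar> = \<bar>(x' - y') - of_int (round (x' - y'))\<bar>"
    by (rule round_dist_cong)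
qed

definition uniformity_circle :: "(circle \<times> circle) filter"
  where "uniformity_circle = (INF e\<in>{0 <..}. principal {(x, y). dist x y < e})"

definition open_circle :: "circle set \<Rightarrow> bool"
  where "open_circle S = (\<forall>x\<in>S. \<forall>\<^sub>F (x', y) in uniformity. x' = x \<longrightarrow> y \<in> S)"

instance
proof
  show "dist x y = 0 \<longleftrightarrow> x = y" for x y :: circle
  proof transfer
    fix x y :: real
    show "\<bar>x - y - of_int (round (x - y))\<bar> = 0 \<longleftrightarrow> x - y \<in> \<int>"
    proof
      assume "\<bar>x - y - of_int (round (x - y))\<bar> = 0"
      then have "x - y = of_int (round (x - y))" by simp
      then show "x - y \<in> \<int>" by (metis Ints_of_int)
    qed (auto elim: Ints_cases)
  qed
  show "dist x y \<le> dist x z + dist y z" for x y z :: circle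
  proof transfer
    fix x y z :: real
    have "\<bar>x - y - of_int (round (x - y))\<bar>
        \<le> \<bar>x - y - of_int (round (x - z) - round (y - z))\<bar>"
      by (rule round_diff_minimal)
    also have "\<dots> \<le> \<bar>x - z - of_int (round (x - z))\<bar> + \<bar>y - z - of_int (round (y - z))\<bar>"
      by simp
    finally show "\<bar>x - y - of_int (round (x - y))\<bar>
        \<le> \<bar>x - z - of_int (round (x - z))\<bar> + \<bar>y - z - of_int (round (y - z))\<bar>" .
  qed
qed (rule open_circle_def uniformity_circle_def)+

end

lemma dist_circle_of_le: "dist (circle_of x) (circle_of y) \<le> \<bar>x - y\<bar>"
  using round_diff_minimal[of "x - y" 0] by (simp add: dist_circle.abs_eq)

lemma continuous_on_circle_of: "continuous_on S circle_of"
  unfolding continuous_on_iff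
  by (metis dist_circle_of_le dist_real_def le_less_trans)

text \<open>By compactness, the bounded continuous functions on the circle, i.e. the elements of the
  type \<open>circle \<Rightarrow>\<^sub>C complex\<close>, are exactly the continuous ones.\<close>

lemma compact_UNIV_circle: "compact (UNIV :: circle set)"
proof -
  have "\<theta> \<in> circle_of ` {0..1}" for \<theta>
  proof -
    obtain x where x: "\<theta> = circle_of x"
      by (metis Quotient3_abs_rep Quotient3_circle)
    have "\<theta> = circle_of (frac x)"
      by (simp add: x circle.abs_eq_iff frac_def)
    moreover have "frac x \<in> {0..1}"
      using frac_lt_1[of x] by (simp add: less_imp_le)
    ultimately show ?thesis by blast
  qed
  then have "UNIV = circle_of ` {0..1}" by blast
  then show ?thesis
    by (metis compact_Icc compact_continuous_image continuous_on_circle_of)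
qed

definition circle_integral :: "(circle \<Rightarrow> 'b::real_normed_vector) \<Rightarrow> 'b"
  where "circle_integral f = integral {0..1} (\<lambda>t. f (circle_of t))"

definition diophantine :: "real \<Rightarrow> bool"
  where "diophantine \<alpha> \<longleftrightarrow> \<alpha> \<notin> \<rat> \<and>
    (\<exists>\<delta>>0. \<exists>\<tau>\<ge>2. \<forall>p q :: int. q \<noteq> 0 \<longrightarrow>
      \<bar>\<alpha> - of_int p / of_int q\<bar> > \<delta> / \<bar>real_of_int q\<bar> powr \<tau>)"


section \<open>Complex Banach spaces and holomorphic maps\<close>

class complex_banach = banach +
  fixes scaleC :: "complex \<Rightarrow> 'a \<Rightarrow> 'a" (infixr \<open>*\<^sub>C\<close> 75)
  assumes scaleC_add_right: "c *\<^sub>C (x + y) = c *\<^sub>C x + c *\<^sub>C y"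
    and scaleC_add_left: "(c + d) *\<^sub>C x = c *\<^sub>C x + d *\<^sub>C x"
    and scaleC_scaleC: "c *\<^sub>C d *\<^sub>C x = (c * d) *\<^sub>C x"
    and scaleC_of_real: "complex_of_real r *\<^sub>C x = r *\<^sub>R x"
    and norm_scaleC: "norm (c *\<^sub>C x) = cmod c * norm x"

instantiation complex :: complex_banach
begin

definition scaleC_complex :: "complex \<Rightarrow> complex \<Rightarrow> complex"
  where "scaleC_complex c z = c * z"

instance
  by standard (simp_all add: scaleC_complex_def algebra_simps norm_mult scaleR_conv_of_real)

end

lemma scaleC_zero_left: "0 *\<^sub>C (x :: 'a::complex_banach) = 0"
  using scaleC_of_real[of 0 x] by simp

lemma bounded_linear_scaleC: "bounded_linear (\<lambda>x :: 'a::complex_banach. c *\<^sub>C x)"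
proof (rule bounded_linear_intro[where K = "cmod c"])
  fix r and x :: 'a
  show "c *\<^sub>C (r *\<^sub>R x) = r *\<^sub>R (c *\<^sub>C x)"
    unfolding scaleC_of_real[symmetric] scaleC_scaleC by (simp add: mult.commute)
qed (simp_all add: scaleC_add_right norm_scaleC)

instantiation bcontfun :: (metric_space, complex_banach) complex_banach
begin

definition scaleC_bcontfun :: "complex \<Rightarrow> ('a \<Rightarrow>\<^sub>C 'b) \<Rightarrow> 'a \<Rightarrow>\<^sub>C 'b"
  where "scaleC_bcontfun c f = Bcontfun (\<lambda>x. c *\<^sub>C apply_bcontfun f x)"

lemma apply_bcontfun_scaleC:
  "apply_bcontfun (c *\<^sub>C f) x = c *\<^sub>C apply_bcontfun f x" for f :: "'a \<Rightarrow>\<^sub>C 'b"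
proof -
  have "bounded ((\<lambda>y. c *\<^sub>C y) ` range (apply_bcontfun f))"
    using bounded_linear_scaleC by (intro bounded_linear_image) auto
  moreover have "continuous_on UNIV (\<lambda>x. c *\<^sub>C apply_bcontfun f x)"
    using bounded_linear.continuous_on[OF bounded_linear_scaleC] by auto
  ultimately have "(\<lambda>x. c *\<^sub>C apply_bcontfun f x) \<in> bcontfun"
    by (simp add: bcontfun_def image_image)
  then show ?thesis
    by (simp add: scaleC_bcontfun_def Bcontfun_inverse)
qed

instance
proof
  fix c d :: complex and r :: real and f g :: "'a \<Rightarrow>\<^sub>C 'b"
  show "c *\<^sub>C (f + g) = c *\<^sub>C f + c *\<^sub>C g"
    by (rule bcontfun_eqI) (simp add: apply_bcontfun_scaleC scaleC_add_right)
  show "(c + d) *\<^sub>C f = c *\<^sub>C f + d *\<^sub>C f"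
    by (rule bcontfun_eqI) (simp add: apply_bcontfun_scaleC scaleC_add_left)
  show *: "c *\<^sub>C d *\<^sub>C f = (c * d) *\<^sub>C f" for c d and f :: "'a \<Rightarrow>\<^sub>C 'b"
    by (rule bcontfun_eqI) (simp add: apply_bcontfun_scaleC scaleC_scaleC)
  show **: "complex_of_real r *\<^sub>C f = r *\<^sub>R f" for r and f :: "'a \<Rightarrow>\<^sub>C 'b"
    by (rule bcontfun_eqI) (simp add: apply_bcontfun_scaleC scaleC_of_real)
  have le: "norm (c *\<^sub>C f) \<le> cmod c * norm f" for c and f :: "'a \<Rightarrow>\<^sub>C 'b"
    by (rule norm_bound)
      (simp add: apply_bcontfun_scaleC norm_scaleC mult_left_mono norm_bounded)
  show "norm (c *\<^sub>C f) = cmod c * norm f"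
  proof (cases "c = 0")
    case True
    then show ?thesis using **[of 0 f] by simp
  next
    case False
    then have "norm f = norm (inverse c *\<^sub>C c *\<^sub>C f)"
      using **[of 1 f] by (simp add: *)
    also have "\<dots> \<le> cmod (inverse c) * norm (c *\<^sub>C f)"
      by (rule le)
    finally have "cmod c * norm f \<le> norm (c *\<^sub>C f)"
      using False by (simp add: norm_inverse norm_divide field_simps)
    with le[of c f] show ?thesis by simp
  qed
qed

end

text \<open>Holomorphic maps between open subsets \<open>M\<close> and \<open>N\<close> of complex Banach spaces. Maps are total
  functions, of which only the values on \<open>M\<close> matter.\<close>

definition holomorphic_map ::
    "('a::complex_banach \<Rightarrow> 'b::complex_banach) \<Rightarrow> 'a set \<Rightarrow> 'b set \<Rightarrow> bool"
  where "holomorphic_map F M N \<longleftrightarrow> open M \<and> open N \<and> F ` M \<subseteq> N \<and>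
    (\<exists>F' :: 'a \<Rightarrow> 'a \<Rightarrow>\<^sub>L 'b. continuous_on M F' \<and>
      (\<forall>x\<in>M. (F has_derivative blinfun_apply (F' x)) (at x) \<and>
        (\<forall>c v. blinfun_apply (F' x) (c *\<^sub>C v) = c *\<^sub>C blinfun_apply (F' x) v)))"

text \<open>The definition by local holomorphic sections. The definition by charts that turn \<open>F\<close> into a
  product projection, to which it is equivalent, quantifies existentially over Banach spaces.\<close>

definition holomorphic_submersion ::
    "('a::complex_banach \<Rightarrow> 'b::complex_banach) \<Rightarrow> 'a set \<Rightarrow> 'b set \<Rightarrow> bool"
  where "holomorphic_submersion F M N \<longleftrightarrow> holomorphic_map F M N \<and>
    (\<forall>x\<in>M. \<exists>V s. open V \<and> F x \<in> V \<and> V \<subseteq> N \<and> holomorphic_map s V M \<and>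
      s (F x) = x \<and> (\<forall>y\<in>V. F (s y) = y))"


section \<open>Quasiperiodically forced quadratic polynomials\<close>

type_synonym circle_fun = "circle \<Rightarrow>\<^sub>C complex"

definition nowhere_vanishing :: "circle_fun set"
  where "nowhere_vanishing = {l. \<forall>\<theta>. apply_bcontfun l \<theta> \<noteq> 0}"

definition fiber_quad :: "circle_fun \<Rightarrow> circle \<Rightarrow> complex \<Rightarrow> complex"
  where "fiber_quad l \<theta> z = z\<^sup>2 + apply_bcontfun l \<theta> * z"

primrec fiber_iter :: "real \<Rightarrow> circle_fun \<Rightarrow> nat \<Rightarrow> circle \<Rightarrow> complex \<Rightarrow> complex"
  where
    "fiber_iter \<alpha> l 0 \<theta> z = z"
  | "fiber_iter \<alpha> l (Suc n) \<theta> z =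
      fiber_quad l (\<theta> + circle_of (real n * \<alpha>)) (fiber_iter \<alpha> l n \<theta> z)"

definition filled_julia :: "real \<Rightarrow> circle_fun \<Rightarrow> (circle \<times> complex) set"
  where "filled_julia \<alpha> l = {(\<theta>, z). bdd_above (range (\<lambda>n. cmod (fiber_iter \<alpha> l n \<theta> z)))}"

definition filled_julia_fiber :: "real \<Rightarrow> circle_fun \<Rightarrow> circle \<Rightarrow> complex set"
  where "filled_julia_fiber \<alpha> l \<theta> = {z. (\<theta>, z) \<in> filled_julia \<alpha> l}"

definition julia :: "real \<Rightarrow> circle_fun \<Rightarrow> (circle \<times> complex) set"
  where "julia \<alpha> l = closure (SIGMA \<theta>:UNIV. frontier (filled_julia_fiber \<alpha> l \<theta>))"

definition hyperbolic :: "real \<Rightarrow> circle_fun \<Rightarrow> bool"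
  where "hyperbolic \<alpha> l \<longleftrightarrow> (\<exists>A>0. \<exists>\<sigma>>1. \<forall>(\<theta>, z) \<in> julia \<alpha> l. \<forall>n.
    cmod (deriv (fiber_iter \<alpha> l n \<theta>) z) \<ge> A * \<sigma> ^ n)"

definition connectedness_locus :: "real \<Rightarrow> circle_fun set"
  where "connectedness_locus \<alpha> = {l. \<forall>\<theta>. connected (filled_julia_fiber \<alpha> l \<theta>)}"

definition main_cardioid :: "real \<Rightarrow> circle_fun set"
  where "main_cardioid \<alpha> = {l \<in> connectedness_locus \<alpha>. hyperbolic \<alpha> l \<and>
    (\<forall>\<theta>. connected (interior (filled_julia_fiber \<alpha> l \<theta>)) \<and>
         interior (filled_julia_fiber \<alpha> l \<theta>) \<noteq> {})}"

definition H0_star :: "real \<Rightarrow> circle_fun set"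
  where "H0_star \<alpha> = {l \<in> main_cardioid \<alpha> \<inter> nowhere_vanishing.
    circle_integral (\<lambda>\<theta>. ln (cmod (apply_bcontfun l \<theta>))) < 0 \<and>
    winding_number (\<lambda>t. apply_bcontfun l (circle_of t)) 0 = 0}"

text \<open>A continuous branch exists when \<open>l\<close> is nowhere vanishing with winding number zero. Two branches
  differ by an integer multiple of \<open>2 \<pi> \<i>\<close>, so the choice does not affect
  \<open>fibered_multiplier\<close>.\<close>

definition log_branch :: "circle_fun \<Rightarrow> circle \<Rightarrow> complex"
  where "log_branch l =
    (SOME g. continuous_on UNIV g \<and> (\<forall>\<theta>. exp (g \<theta>) = apply_bcontfun l \<theta>))"

definition fibered_multiplier :: "circle_fun \<Rightarrow> complex"
  where "fibered_multiplier l = exp (circle_integral (log_branch l))"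

definition punctured_disk :: "complex set"
  where "punctured_disk = ball 0 1 - {0}"

end

theory Submission
  imports Defs
begin

text \<open>The derivative of the multiplier is easy. Near \<open>l0\<close> one may write a logarithm of \<open>l\<close> as a
  logarithm of \<open>l0\<close> plus \<open>Ln (l / l0)\<close>, so the multiplier \<open>\<kappa> l\<close> is
  \<open>\<kappa> l0 * exp (\<integral> Ln (l / l0))\<close> and has the complex linear derivative
  \<open>h \<mapsto> \<kappa> l0 * \<integral> h / l0\<close>. Since \<open>\<kappa> (c l) = c \<kappa> l\<close>, the linear map
  \<open>y \<mapsto> (y / \<kappa> l) l\<close> is a section through \<open>l\<close>. The substance of the theorem is that the
  domain is open, a case of Sester's openness of the main cardioid.

  The proof of openness replaces the definition of the cardioid by a condition that visibly survives
  perturbation: in every fiber, the critical point \<open>- l \<theta> / 2\<close> can be joined to \<open>0\<close> inside the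
  basin of the invariant curve \<open>0\<close>.

  As the Lyapunov exponent \<open>\<integral> ln \<bar>l\<bar>\<close> is negative and the rotation is irrational, some
  Birkhoff average of \<open>ln \<bar>l\<bar>\<close> is uniformly negative, and a coboundary turns this
  into a weight \<open>w\<close> for which \<open>w \<theta> * \<bar>z\<bar>\<close> is contracted in one step near the zero
  section (\<open>coboundary_correction_negative\<close>, \<open>attracting_weight_nearby\<close>). The
  same weight serves all nearby parameters.

  The condition holds on the domain: there the interior of each fiber of the filled-in Julia set is
  connected. By equicontinuity of bounded iterates it is the basin, by the maximum principle it is
  simply connected, and if it missed the critical value, then a square root would split its
  preimage, which is the connected basin of the previous fiber
  (\<open>joined_of_connected_interiors\<close>).

  The condition implies membership (\<open>main_cardioid_of_joined\<close>). Preimages of connected open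
  sets containing the critical value are connected, which makes the filled-in fibers and the basins
  connected. Uniform expansion off the basin (\<open>expansion_off_basin\<close>) comes from pulling back
  discs that avoid the critical values: each pullback lands at a definite distance from the boundary
  of the region allowed, so it can be enlarged by a fixed factor before the next step, while its
  derivative stays bounded by Cauchy's estimate. Expansion gives hyperbolicity, and it shows that the
  interior of the filled-in fiber is nothing but the basin.\<close>


section \<open>Topology and integration on the circle\<close>

lemma circle_of_add: "circle_of (x + y) = circle_of x + circle_of y"
  by (simp add: plus_circle.abs_eq)

lemma circle_of_0 [simp]: "circle_of 0 = 0"
  by (simp add: zero_circle_def)

lemma circle_of_eq_iff: "circle_of x = circle_of y \<longleftrightarrow> x - y \<in> \<int>"
  by (simp add: circle.abs_eq_iff)

lemma circle_of_surj: "\<exists>t\<in>{0..<1}. \<theta> = circle_of t"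
proof -
  obtain x where x: "\<theta> = circle_of x"
    by (metis Quotient3_abs_rep Quotient3_circle)
  have "\<theta> = circle_of (frac x)"
    by (simp add: x circle.abs_eq_iff frac_def)
  then show ?thesis
    by (intro bexI[of _ "frac x"]) (auto simp: frac_lt_1)
qed

lemma dist_circle_add_right [simp]: "dist (x + c) (y + c) = dist x (y :: circle)"
  by transfer simp

lemma dist_circle_add_left [simp]: "dist (c + x) (c + y) = dist x (y :: circle)"
  by transfer simp

lemma continuous_on_circle_translate [continuous_intros]:
  "continuous_on S f \<Longrightarrow> continuous_on S (\<lambda>x. f x + (c :: circle))"
proof (rule continuous_on_compose2[of UNIV "\<lambda>x. x + c"])
  show "continuous_on UNIV (\<lambda>x :: circle. x + c)"
    unfolding continuous_on_iff dist_circle_add_right by blast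
qed auto

instance circle :: heine_borel
proof
  fix f :: "nat \<Rightarrow> circle"
  show "\<exists>l r. strict_mono r \<and> (f \<circ> r) \<longlonglongrightarrow> l"
    using compact_UNIV_circle compact_imp_seq_compact seq_compactE by (metis UNIV_I)
qed

lemma circle_continuous_bounded:
  fixes f :: "circle \<Rightarrow> 'b::metric_space"
  assumes "continuous_on UNIV f"
  shows "bounded (range f)"
  by (simp add: assms compact_UNIV_circle compact_continuous_image compact_imp_bounded)

lemma continuous_on_circle_lift:
  assumes "continuous_on UNIV f"
  shows "continuous_on S (\<lambda>t. f (circle_of t))"
  by (metis assms continuous_on_circle_of continuous_on_compose2 subset_UNIV)

lemma circle_integrable:
  fixes f :: "circle \<Rightarrow> 'b::banach"
  assumes "continuous_on UNIV f"
  shows "(\<lambda>t. f (circle_of t)) integrable_on {a..b}"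
  by (simp add: assms continuous_on_circle_lift integrable_continuous_interval)

lemma circle_integral_le:
  fixes f g :: "circle \<Rightarrow> real"
  assumes "continuous_on UNIV f" "continuous_on UNIV g" "\<And>\<theta>. f \<theta> \<le> g \<theta>"
  shows "circle_integral f \<le> circle_integral g"
  unfolding circle_integral_def
  by (intro integral_le circle_integrable assms)

lemma circle_integral_const [simp]: "circle_integral (\<lambda>_. c) = (c :: 'b::euclidean_space)"
  by (simp add: circle_integral_def)

lemma circle_integral_add:
  fixes f g :: "circle \<Rightarrow> 'b::banach"
  assumes "continuous_on UNIV f" "continuous_on UNIV g"
  shows "circle_integral (\<lambda>\<theta>. f \<theta> + g \<theta>) = circle_integral f + circle_integral g"
  unfolding circle_integral_def by (intro integral_add circle_integrable assms)

lemma circle_integral_sum: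
  fixes f :: "'i \<Rightarrow> circle \<Rightarrow> 'b::banach"
  assumes "finite I" "\<And>i. i \<in> I \<Longrightarrow> continuous_on UNIV (f i)"
  shows "circle_integral (\<lambda>\<theta>. \<Sum>i\<in>I. f i \<theta>) = (\<Sum>i\<in>I. circle_integral (f i))"
  unfolding circle_integral_def by (intro integral_sum circle_integrable assms)

lemma circle_integral_norm_le:
  fixes f :: "circle \<Rightarrow> 'b::banach"
  assumes "continuous_on UNIV f" "\<And>\<theta>. norm (f \<theta>) \<le> B"
  shows "norm (circle_integral f) \<le> B"
proof -
  have "norm (integral {0..1} (\<lambda>t. f (circle_of t))) \<le> integral {0..1} (\<lambda>t::real. B)"
    by (rule integral_norm_bound_integral) (use assms circle_integrable[of f 0 1] in auto)
  then show ?thesis by (simp add: circle_integral_def)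
qed

lemma circle_integral_diff:
  fixes f g :: "circle \<Rightarrow> 'b::banach"
  assumes "continuous_on UNIV f" "continuous_on UNIV g"
  shows "circle_integral (\<lambda>\<theta>. f \<theta> - g \<theta>) = circle_integral f - circle_integral g"
  unfolding circle_integral_def by (intro integral_diff circle_integrable assms)

lemma circle_integral_Re:
  assumes "continuous_on UNIV g"
  shows "Re (circle_integral g) = circle_integral (\<lambda>\<theta>. Re (g \<theta>))"
  using integral_linear[OF circle_integrable[OF assms, of 0 1] bounded_linear_Re]
  by (simp add: circle_integral_def o_def)

lemma circle_integral_mult_left:
  fixes f :: "circle \<Rightarrow> complex"
  shows "circle_integral (\<lambda>\<theta>. c * f \<theta>) = c * circle_integral f"
  by (simp add: circle_integral_def)

text \<open>Over one period it does not matter where the interval of integration starts: the integral over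
  \<open>{a..1 + a}\<close> splits at \<open>1\<close>, and its second part shifts back to \<open>{0..a}\<close>.\<close>

lemma circle_integral_translate:
  fixes f :: "circle \<Rightarrow> 'b::banach"
  assumes f: "continuous_on UNIV f"
  shows "circle_integral (\<lambda>\<theta>. f (\<theta> + c)) = circle_integral f"
proof -
  obtain a where a: "0 \<le> a" "a < 1" "c = circle_of a"
    using circle_of_surj[of c] by auto
  define F where "F = (\<lambda>t. f (circle_of t))"
  have int: "F integrable_on {u..v}" for u v
    unfolding F_def by (rule circle_integrable[OF f])
  have per: "F (t + 1) = F t" for t
  proof -
    have "circle_of (t + 1) = circle_of t"
      by (simp only: circle_of_eq_iff) simp
    then show ?thesis by (simp only: F_def)
  qed
  have shift: "integral {u + s..v + s} F = integral {u..v} (\<lambda>t. F (t + s))" for u v s :: real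
    using integral_shift_Icc_real[of u v F s] by (simp only: o_def add.commute[of s])
  have "circle_integral (\<lambda>\<theta>. f (\<theta> + c)) = integral {0..1} (\<lambda>t. F (t + a))"
    by (simp add: circle_integral_def F_def a circle_of_add)
  also have "\<dots> = integral {a..1 + a} F"
    using shift[of 0 a 1] by simp
  also have "\<dots> = integral {a..1} F + integral {1..1 + a} F"
    by (rule Henstock_Kurzweil_Integration.integral_combine[symmetric]) (use a int in auto)
  also have "integral {1..1 + a} F = integral {0..a} F"
    using shift[of 0 1 a] by (simp add: per add.commute)
  also have "integral {a..1} F + integral {0..a} F = integral {0..1} F"
    using Henstock_Kurzweil_Integration.integral_combine[of 0 a 1 F] a int by (simp add: add.commute)
  finally show ?thesis by (simp add: circle_integral_def F_def)
qed

lemma connected_UNIV_circle: "connected (UNIV :: circle set)"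
proof -
  have "UNIV = circle_of ` {0..1}"
    using circle_of_surj by fastforce
  then show ?thesis
    by (metis connected_Icc connected_continuous_image continuous_on_circle_of)
qed

text \<open>The map \<open>circle_of\<close> sends compact sets to closed sets, so it is a quotient map on the unit
  interval: preimages of closed sets under the descended function are images of compact sets.\<close>

lemma continuous_on_circle_descend:
  fixes q :: "real \<Rightarrow> 'b::t2_space"
  assumes q: "continuous_on {0..1} q" "q 0 = q 1"
  obtains g where "continuous_on UNIV g" "\<And>t. t \<in> {0..1} \<Longrightarrow> g (circle_of t) = q t"
proof -
  \<comment> \<open>Representatives are chosen in the half-open interval. At the other endpoint, the hypothesis on the
    endpoint values takes over.\<close>
  define s where "s \<theta> = (SOME t. t \<in> {0..<1} \<and> circle_of t = \<theta>)" for \<theta>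
  have s: "s \<theta> \<in> {0..<1}" "circle_of (s \<theta>) = \<theta>" for \<theta>
  proof -
    have "\<exists>t. t \<in> {0..<1} \<and> circle_of t = \<theta>"
      using circle_of_surj[of \<theta>] by metis
    from someI_ex[OF this] show "s \<theta> \<in> {0..<1}" "circle_of (s \<theta>) = \<theta>"
      unfolding s_def by blast+
  qed
  define g where "g = q \<circ> s"
  have g: "g (circle_of t) = q t" if t: "t \<in> {0..1}" for t
  proof -
    have "t - s (circle_of t) \<in> \<int>"
      using s(2)[of "circle_of t"] circle_of_eq_iff by metis
    then obtain k where k: "t - s (circle_of t) = of_int k"
      by (auto elim: Ints_cases)
    then have "of_int k > (-1 :: real)" "of_int k \<le> (1 :: real)"
      using t s(1)[of "circle_of t"] by auto
    then have "k = 0 \<or> k = 1" by linarith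
    then have "s (circle_of t) = t \<or> (t = 1 \<and> s (circle_of t) = 0)"
      using k t s(1)[of "circle_of t"] by auto
    then show ?thesis using q(2) by (auto simp: g_def)
  qed
  have "continuous_on UNIV g"
    unfolding continuous_on_closed_vimage[OF closed_UNIV]
  proof (intro allI impI)
    fix C :: "'b set" assume "closed C"
    have "g -` C \<inter> UNIV = circle_of ` (q -` C \<inter> {0..1})"
    proof (intro equalityI subsetI)
      fix \<theta> assume "\<theta> \<in> g -` C \<inter> UNIV"
      then have "s \<theta> \<in> q -` C \<inter> {0..1}"
        using s(1)[of \<theta>] by (auto simp: g_def)
      then show "\<theta> \<in> circle_of ` (q -` C \<inter> {0..1})"
        using s(2)[of \<theta>] by (metis image_eqI)
    qed (use g in auto)
    moreover have "closed (q -` C \<inter> {0..1})"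
      using q(1) \<open>closed C\<close> by (simp add: continuous_on_closed_vimage)
    then have "compact (q -` C \<inter> {0..1})"
      by (metis compact_Icc closed_Int_compact inf.idem inf_assoc)
    then have "compact (circle_of ` (q -` C \<inter> {0..1}))"
      by (intro compact_continuous_image continuous_on_circle_of)
    ultimately show "closed (g -` C \<inter> UNIV)"
      by (metis compact_imp_closed)
  qed
  then show ?thesis using that g by blast
qed

text \<open>The tube lemma. It turns every pointwise strict inequality that is jointly continuous in a parameter
  and a point of the circle into an open condition on the parameter.\<close>

lemma open_all_circle:
  fixes W :: "('a::topological_space \<times> circle) set"
  assumes "open W"
  shows "open {x. \<forall>\<theta>. (x, \<theta>) \<in> W}"
proof (subst open_subopen, safe)
  fix x assume "\<forall>\<theta>. (x, \<theta>) \<in> W"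
  then have "{x} \<times> UNIV \<subseteq> W" by auto
  from Elementary_Topology.tube_lemma[OF compact_UNIV_circle assms this]
  obtain X where X: "x \<in> X" "open X" "X \<times> UNIV \<subseteq> W" by blast
  then show "\<exists>T. open T \<and> x \<in> T \<and> T \<subseteq> {x. \<forall>\<theta>. (x, \<theta>) \<in> W}"
    by (intro exI[of _ X]) auto
qed


section \<open>Birkhoff averages over an irrational rotation\<close>

text \<open>By compactness of the circle the density of the orbit is uniform: a bounded number of steps
  suffices for all targets.\<close>

lemma rotation_orbit_dense:
  assumes "\<alpha> \<notin> \<rat>" "e > 0"
  obtains J where "\<And>c. \<exists>j\<le>J. dist (circle_of (real j * \<alpha>)) c < e"
proof -
  have "UNIV \<subseteq> (\<Union>j. ball (circle_of (real j * \<alpha>)) e)"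
  proof
    fix c :: circle
    obtain t where t: "0 \<le> t" "t < 1" "c = circle_of t"
      using circle_of_surj[of c] by auto
    obtain k where k: "\<bar>frac (real k * \<alpha>) - t\<bar> < e"
      using Kronecker_approx_1_explicit[OF assms(1), of t e] assms(2) t by auto
    have "circle_of (frac (real k * \<alpha>)) = circle_of (real k * \<alpha>)"
      by (simp add: circle_of_eq_iff frac_def)
    then have "dist (circle_of (real k * \<alpha>)) c < e"
      using k dist_circle_of_le[of "frac (real k * \<alpha>)" t] by (simp add: t)
    then show "c \<in> (\<Union>j. ball (circle_of (real j * \<alpha>)) e)"
      by auto
  qed
  then obtain I where I: "finite I" "UNIV \<subseteq> (\<Union>j\<in>I. ball (circle_of (real j * \<alpha>)) e)"
    using compactE_image[OF compact_UNIV_circle, of UNIV "\<lambda>j. ball (circle_of (real j * \<alpha>)) e"]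
    by auto
  show ?thesis
  proof
    fix c
    have "c \<in> (\<Union>j\<in>I. ball (circle_of (real j * \<alpha>)) e)"
      using I(2) by blast
    then obtain j where "j \<in> I" "dist (circle_of (real j * \<alpha>)) c < e"
      by auto
    then show "\<exists>j\<le>Max I. dist (circle_of (real j * \<alpha>)) c < e"
      using I(1) by (meson Max_ge)
  qed
qed

text \<open>Sums along the orbits of \<open>\<theta>\<close> and of its translate by \<open>j \<alpha>\<close> differ in at most \<open>2 j\<close>
  terms. As boundedly many steps take \<open>\<theta>\<close> close to any other point, the normalized sums
  become nearly constant in \<open>\<theta>\<close>, and their mean is the integral.\<close>

lemma birkhoff_average_le:
  fixes f :: "circle \<Rightarrow> real"
  assumes "\<alpha> \<notin> \<rat>" "continuous_on UNIV f" "e > 0"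
  obtains n where "n > 0"
    "\<And>\<theta>. (\<Sum>k<n. f (\<theta> + circle_of (real k * \<alpha>))) \<le> real n * (circle_integral f + e)"
proof -
  define S where "S n \<theta> = (\<Sum>k<n. f (\<theta> + circle_of (real k * \<alpha>)))" for n \<theta>
  obtain B where B: "B > 0" "\<And>\<theta>. \<bar>f \<theta>\<bar> \<le> B"
    using circle_continuous_bounded[OF assms(2)] by (auto simp: bounded_pos)
  obtain d where d: "d > 0" "\<And>x y. dist x y < d \<Longrightarrow> \<bar>f x - f y\<bar> < e/2"
    using compact_uniformly_continuous[OF assms(2) compact_UNIV_circle] \<open>e > 0\<close>
    unfolding uniformly_continuous_on_def dist_real_def by (metis UNIV_I half_gt_zero)
  obtain J where J: "\<And>c. \<exists>j\<le>J. dist (circle_of (real j * \<alpha>)) c < d"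
    using rotation_orbit_dense[OF assms(1) d(1)] by blast
  have step: "\<bar>S n (\<theta> + circle_of (real j * \<alpha>)) - S n \<theta>\<bar> \<le> 2 * real j * B" for n j \<theta>
  proof (induction j)
    case (Suc j)
    let ?t = "\<theta> + circle_of (real j * \<alpha>)"
    have "f ?t + (\<Sum>k<n. f (?t + circle_of \<alpha> + circle_of (real k * \<alpha>)))
        = (\<Sum>k<Suc n. f (?t + circle_of (real k * \<alpha>)))"
      by (subst sum.lessThan_Suc_shift) (simp add: algebra_simps circle_of_add)
    then have "S n (?t + circle_of \<alpha>) - S n ?t = f (?t + circle_of (real n * \<alpha>)) - f ?t"
      by (simp add: S_def)
    moreover have "\<theta> + circle_of (real (Suc j) * \<alpha>) = ?t + circle_of \<alpha>"
      by (simp add: algebra_simps circle_of_add)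
    ultimately show ?case
      using Suc B(2)[of ?t] B(2)[of "?t + circle_of (real n * \<alpha>)"] by (simp add: algebra_simps)
  qed simp
  obtain n where n: "real n > 4 * real J * B / e"
    using reals_Archimedean2 by blast
  moreover have "4 * real J * B / e \<ge> 0"
    using B(1) assms(3) by simp
  ultimately have "n > 0"
    by (metis of_nat_0_less_iff order_le_less_trans)
  have nJ: "2 * real J * B \<le> real n * (e / 2)"
    using n assms(3) by (simp add: field_simps)
  have comp: "S n \<theta>' \<le> S n \<theta> + real n * e" for \<theta> \<theta>'
  proof -
    obtain j where j: "j \<le> J" "dist (circle_of (real j * \<alpha>)) (\<theta>' - \<theta>) < d"
      using J by blast
    then have "dist (\<theta> + circle_of (real j * \<alpha>)) \<theta>' < d"
      using dist_circle_add_left[of \<theta> "circle_of (real j * \<alpha>)" "\<theta>' - \<theta>"] by simp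
    then have "\<bar>f (\<theta>' + c) - f (\<theta> + circle_of (real j * \<alpha>) + c)\<bar> < e / 2" for c
      by (intro d) (simp add: dist_commute)
    then have "f (\<theta>' + c) \<le> f (\<theta> + circle_of (real j * \<alpha>) + c) + e / 2" for c
      by (smt (verit))
    then have "S n \<theta>' \<le> (\<Sum>k<n. f (\<theta> + circle_of (real j * \<alpha>) + circle_of (real k * \<alpha>)) + e / 2)"
      unfolding S_def by (intro sum_mono)
    then have "S n \<theta>' \<le> S n (\<theta> + circle_of (real j * \<alpha>)) + real n * (e / 2)"
      by (simp add: S_def sum.distrib)
    moreover have "2 * real j * B \<le> 2 * real J * B"
      using j B(1) by simp
    ultimately show ?thesis
      using step[of n \<theta> j] nJ by (simp add: algebra_simps)
  qed
  have cont: "continuous_on UNIV (\<lambda>\<theta>. f (\<theta> + c))" for c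
    by (rule continuous_on_compose2[OF assms(2)]) (auto intro!: continuous_intros)
  have contS: "continuous_on UNIV (S n)"
    unfolding S_def by (intro continuous_intros cont)
  have "circle_integral (S n) = real n * circle_integral f"
    unfolding S_def by (simp add: circle_integral_sum cont circle_integral_translate assms(2))
  moreover have "S n \<theta>' \<le> circle_integral (S n) + real n * e" for \<theta>'
  proof -
    have "circle_integral (\<lambda>\<theta>. S n \<theta>') \<le> circle_integral (\<lambda>\<theta>. S n \<theta> + real n * e)"
      by (intro circle_integral_le comp continuous_intros contS)
    then show ?thesis
      by (simp add: circle_integral_add contS)
  qed
  ultimately show ?thesis
    using that[OF \<open>n > 0\<close>] by (simp add: S_def algebra_simps)
qed

text \<open>The function \<open>f\<close> is cohomologous to its average along orbit segments of length \<open>n\<close>. The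
  transfer function is the mean of the first \<open>n\<close> partial sums.\<close>

lemma coboundary_correction_negative:
  fixes f :: "circle \<Rightarrow> real"
  assumes "\<alpha> \<notin> \<rat>" "continuous_on UNIV f" "circle_integral f < 0"
  obtains u e where "continuous_on UNIV u" "e > 0"
    "\<And>\<theta>. f \<theta> + u (\<theta> + circle_of \<alpha>) - u \<theta> \<le> - e"
proof -
  define e where "e = - circle_integral f / 2"
  have "e > 0" using assms(3) by (simp add: e_def)
  obtain n where n: "n > 0"
      "\<And>\<theta>. (\<Sum>k<n. f (\<theta> + circle_of (real k * \<alpha>))) \<le> real n * (circle_integral f + e)"
    using birkhoff_average_le[OF assms(1,2) \<open>e > 0\<close>] by blast
  define S where "S j \<theta> = (\<Sum>k<j. f (\<theta> + circle_of (real k * \<alpha>)))" for j \<theta>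
  define u where "u \<theta> = (\<Sum>j<n. S j \<theta>) / real n" for \<theta>
  have cont: "continuous_on UNIV (\<lambda>\<theta>. f (\<theta> + c))" for c
    by (rule continuous_on_compose2[OF assms(2)]) (auto intro!: continuous_intros)
  have contu: "continuous_on UNIV u"
    unfolding u_def S_def using n(1) by (intro continuous_intros cont) auto
  have Sd: "S j (\<theta> + circle_of \<alpha>) - S j \<theta> = f (\<theta> + circle_of (real j * \<alpha>)) - f \<theta>" for j \<theta>
  proof -
    have "f \<theta> + (\<Sum>k<j. f (\<theta> + circle_of \<alpha> + circle_of (real k * \<alpha>)))
        = (\<Sum>k<Suc j. f (\<theta> + circle_of (real k * \<alpha>)))"
      by (subst sum.lessThan_Suc_shift) (simp add: algebra_simps circle_of_add)
    then show ?thesis by (simp add: S_def)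
  qed
  have "f \<theta> + u (\<theta> + circle_of \<alpha>) - u \<theta> \<le> - e" for \<theta>
  proof -
    have "(\<Sum>j<n. S j (\<theta> + circle_of \<alpha>)) - (\<Sum>j<n. S j \<theta>)
        = (\<Sum>j<n. f (\<theta> + circle_of (real j * \<alpha>)) - f \<theta>)"
      by (simp add: Sd flip: sum_subtractf)
    also have "\<dots> = (\<Sum>j<n. f (\<theta> + circle_of (real j * \<alpha>))) - real n * f \<theta>"
      by (simp add: sum_subtractf)
    also have "\<dots> \<le> real n * (- e) - real n * f \<theta>"
      using n(2)[of \<theta>] by (simp add: e_def)
    finally have "real n * (u (\<theta> + circle_of \<alpha>) - u \<theta>) \<le> real n * (- e - f \<theta>)"
      using n(1) by (simp add: u_def algebra_simps)
    then show ?thesis using n(1) by simp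
  qed
  then show ?thesis using that contu \<open>e > 0\<close> by blast
qed


section \<open>Quadratic preimages and bounded holomorphic functions\<close>

lemma quadratic_complete_square: "z\<^sup>2 + a * z = (z + a/2)\<^sup>2 - (a/2)\<^sup>2" for a z :: complex
  by (simp add: power2_eq_square field_simps)

lemma open_quadratic_vimage:
  assumes "open W"
  shows "open {z :: complex. z\<^sup>2 + a * z \<in> W}"
proof -
  have "open ((\<lambda>z. z\<^sup>2 + a * z) -` W)"
    by (intro open_vimage assms continuous_intros)
  then show ?thesis by (simp add: vimage_def)
qed

lemma open_quadratic_image:
  assumes "open W"
  shows "open ((\<lambda>z :: complex. z\<^sup>2 + a * z) ` W)"
proof (rule open_mapping_thm[of _ UNIV])
  show "\<not> (\<lambda>z. z\<^sup>2 + a * z) constant_on UNIV"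
  proof
    assume "(\<lambda>z. z\<^sup>2 + a * z) constant_on UNIV"
    then obtain c where "\<And>z. z\<^sup>2 + a * z = c"
      by (auto simp: constant_on_def)
    from this[of 0] this[of 1] this[of "-1"] show False by (simp add: add_eq_0_iff)
  qed
qed (use assms in \<open>auto intro!: holomorphic_intros\<close>)

text \<open>A quadratic polynomial is a double cover branched over its critical value, so a separation of
  the preimage can be made invariant under the deck involution \<open>z \<mapsto> - a - z\<close>: the side of the
  critical point is replaced by the part that the involution keeps there. The images of the two new
  sides are then disjoint and separate \<open>W\<close>.\<close>

lemma connected_quadratic_vimage:
  fixes a :: complex
  assumes W: "open W" "connected W" and crit: "- (a/2)\<^sup>2 \<in> W"
  shows "connected {z. z\<^sup>2 + a * z \<in> W}"
proof -
  let ?q = "\<lambda>z. z\<^sup>2 + a * z"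
  define S where "S = {z. ?q z \<in> W}"
  have refl: "?q (- a - z) = ?q z" for z
    by (simp add: power2_eq_square algebra_simps)
  have opS: "open S"
    unfolding S_def by (rule open_quadratic_vimage[OF W(1)])
  have cS: "- a/2 \<in> S"
    using crit by (simp add: S_def power2_eq_square)
  have "False" if AB: "open A" "open B" "A \<inter> B = {}" "A \<union> B = S" "- a/2 \<in> A" "B \<noteq> {}" for A B
  proof -
    \<comment> \<open>Both new sides are invariant under the involution, and the critical point is its fixed point.\<close>
    define A' where "A' = A \<inter> (\<lambda>z. - a - z) -` A"
    define B' where "B' = B \<union> (\<lambda>z. - a - z) -` B"
    have mem: "z \<in> S \<longleftrightarrow> - a - z \<in> S" for z
      using refl[of z] by (simp add: S_def)
    have op: "open A'" "open B'"
      unfolding A'_def B'_def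
      by (intro open_Int open_Un open_vimage AB continuous_intros)+
    have cov: "A' \<union> B' = S"
      using AB(3,4) mem unfolding A'_def B'_def by blast
    have disj: "?q ` A' \<inter> ?q ` B' = {}"
    proof (rule ccontr)
      assume "?q ` A' \<inter> ?q ` B' \<noteq> {}"
      then obtain x y where xy: "x \<in> A'" "y \<in> B'" "?q x = ?q y" by auto
      then have "(x - y) * (x + y + a) = 0"
        by (simp add: power2_eq_square algebra_simps)
      then have "x - y = 0 \<or> x + y + a = 0"
        by (simp only: mult_eq_0_iff)
      then have "x = y \<or> x = - a - y"
        by (auto simp: algebra_simps eq_neg_iff_add_eq_0)
      then show False
        using xy AB(3) unfolding A'_def B'_def by auto
    qed
    have surj: "?q ` S = W"
    proof -
      have "w \<in> ?q ` S" if "w \<in> W" for w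
      proof (rule image_eqI)
        show "w = ?q (csqrt (w + (a/2)\<^sup>2) - a/2)"
          unfolding quadratic_complete_square by simp
        then show "csqrt (w + (a/2)\<^sup>2) - a/2 \<in> S"
          using that by (simp add: S_def)
      qed
      then show ?thesis by (auto simp: S_def)
    qed
    have "?q ` A' \<union> ?q ` B' = W"
      using surj cov by (metis image_Un)
    moreover have "- a/2 \<in> A'" using AB(5) by (simp add: A'_def)
    moreover have "B' \<noteq> {}" using AB(6) by (auto simp: B'_def)
    ultimately show False
      using connectedD[OF W(2) open_quadratic_image[OF op(1)] open_quadratic_image[OF op(2)]] disj
      by blast
  qed
  then have sep: "- a/2 \<notin> A \<or> B = {}" if "open A" "open B" "A \<inter> B = {}" "A \<union> B = S" for A B
    using that by blast
  have "connected S"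
  proof (rule connectedI)
    fix A B assume AB: "open A" "open B" "A \<inter> S \<noteq> {}" "B \<inter> S \<noteq> {}" "A \<inter> B \<inter> S = {}" "S \<subseteq> A \<union> B"
    have "open (A \<inter> S)" "open (B \<inter> S)" "A \<inter> S \<inter> (B \<inter> S) = {}" "A \<inter> S \<union> B \<inter> S = S"
      using AB opS by auto
    then show False
      using sep[of "A \<inter> S" "B \<inter> S"] sep[of "B \<inter> S" "A \<inter> S"] AB(3,4) cS
      by (metis UnE inf_commute sup_commute)
  qed
  then show ?thesis by (simp add: S_def)
qed

text \<open>Completing the square, a lift of \<open>f\<close> is a branch of the square root of \<open>f\<close> minus the critical
  value. The sign is adjusted to the prescribed base point.\<close>

lemma quadratic_lift:
  fixes a :: complex
  assumes S: "convex S" "\<xi> \<in> S" and f: "f holomorphic_on S" and omit: "- (a/2)\<^sup>2 \<notin> f ` S"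
    and base: "f \<xi> = z\<^sup>2 + a * z"
  obtains g where "g holomorphic_on S" "g \<xi> = z" "\<And>\<zeta>. \<zeta> \<in> S \<Longrightarrow> (g \<zeta>)\<^sup>2 + a * g \<zeta> = f \<zeta>"
proof -
  have "(\<lambda>\<zeta>. f \<zeta> + (a/2)\<^sup>2) holomorphic_on S"
    by (intro holomorphic_intros f)
  moreover have "f \<zeta> + (a/2)\<^sup>2 \<noteq> 0" if "\<zeta> \<in> S" for \<zeta>
    using omit that by (metis add_eq_0_iff2 image_eqI)
  ultimately obtain s where s: "s holomorphic_on S" "\<And>\<zeta>. \<zeta> \<in> S \<Longrightarrow> f \<zeta> + (a/2)\<^sup>2 = (s \<zeta>)\<^sup>2"
    by (rule contractible_imp_holomorphic_sqrt[OF _ convex_imp_contractible[OF S(1)]]) blast+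
  have "(s \<xi>)\<^sup>2 = (z + a/2)\<^sup>2"
    using s(2)[OF S(2)] unfolding base quadratic_complete_square by simp
  then obtain e where e: "e\<^sup>2 = 1" "e * s \<xi> = z + a/2"
    by (metis power2_eq_iff mult_1 mult_minus1 one_power2 power2_minus)
  show ?thesis
  proof
    show "(\<lambda>\<zeta>. e * s \<zeta> - a/2) holomorphic_on S"
      by (intro holomorphic_intros s)
    show "e * s \<xi> - a/2 = z" by (simp add: e)
    show "(e * s \<zeta> - a/2)\<^sup>2 + a * (e * s \<zeta> - a/2) = f \<zeta>" if "\<zeta> \<in> S" for \<zeta>
      unfolding quadratic_complete_square
      by (simp add: power_mult_distrib e(1) s(2)[OF that, symmetric])
  qed
qed

text \<open>Otherwise \<open>w \<mapsto> w + (a/2)\<^sup>2\<close> has a holomorphic square root \<open>s\<close> on \<open>U\<close>. The quotient of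
  \<open>z + a/2\<close> by \<open>s\<close> at the image of \<open>z\<close> takes the values \<open>1\<close> and \<open>-1\<close> only, and
  both at the two preimages of one point, which disconnects the preimage of \<open>U\<close>.\<close>

lemma critical_value_in_simply_connected:
  fixes a :: complex
  assumes U: "open U" "simply_connected U" "U \<noteq> {}"
    and conn: "connected {z. z\<^sup>2 + a * z \<in> U}"
  shows "- (a/2)\<^sup>2 \<in> U"
proof (rule ccontr)
  assume notin: "- (a/2)\<^sup>2 \<notin> U"
  have "(\<lambda>w. w + (a/2)\<^sup>2) holomorphic_on U"
    by (intro holomorphic_intros)
  moreover have nz: "w + (a/2)\<^sup>2 \<noteq> 0" if "w \<in> U" for w
    using notin that by (metis add_eq_0_iff2)
  ultimately obtain s where s: "s holomorphic_on U" "\<And>w. w \<in> U \<Longrightarrow> w + (a/2)\<^sup>2 = (s w)\<^sup>2"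
    by (rule simply_connected_imp_holomorphic_sqrt[OF _ U(2) open_imp_locally_path_connected[OF U(1)]])
       blast+
  let ?q = "\<lambda>z. z\<^sup>2 + a * z"
  define V where "V = {z. ?q z \<in> U}"
  define \<epsilon> where "\<epsilon> z = (z + a/2) / s (?q z)" for z
  have s_nz: "s w \<noteq> 0" if "w \<in> U" for w
    using s(2)[OF that] nz[OF that] by auto
  have sq: "(\<epsilon> z)\<^sup>2 = 1" if "z \<in> V" for z
  proof -
    have eq: "(s (?q z))\<^sup>2 = (z + a/2)\<^sup>2"
      using s(2)[of "?q z"] that by (simp add: V_def quadratic_complete_square)
    have "s (?q z) \<noteq> 0"
      using s_nz that by (simp add: V_def)
    then have "(s (?q z))\<^sup>2 / (s (?q z))\<^sup>2 = 1"
      by simp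
    then show ?thesis
      unfolding \<epsilon>_def power_divide by (simp only: eq)
  qed
  have "continuous_on V (\<lambda>z. s (?q z))"
    by (rule continuous_on_compose2[OF holomorphic_on_imp_continuous_on[OF s(1)]])
       (auto simp: V_def intro!: continuous_intros)
  then have "continuous_on V \<epsilon>"
    unfolding \<epsilon>_def using s_nz by (intro continuous_intros) (auto simp: V_def)
  then have "connected (\<epsilon> ` V)"
    using conn unfolding V_def by (rule connected_continuous_image)
  moreover have "\<epsilon> ` V \<subseteq> {1, -1}"
    using sq by (auto simp: power2_eq_1_iff)
  then have "finite (\<epsilon> ` V)"
    by (meson finite.simps finite_subset)
  ultimately have "\<epsilon> ` V = {} \<or> (\<exists>e. \<epsilon> ` V = {e})"
    by (simp add: connected_finite_iff_sing)
  then obtain e where e: "\<epsilon> ` V \<subseteq> {e}"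
    by auto
  obtain w where "w \<in> U" using U(3) by blast
  define z where "z = csqrt (w + (a/2)\<^sup>2) - a/2"
  have "z \<in> V"
    using \<open>w \<in> U\<close> unfolding V_def z_def quadratic_complete_square by simp
  have refl: "?q (- a - z) = ?q z"
    by (simp add: power2_eq_square algebra_simps)
  then have "- a - z \<in> V" using \<open>z \<in> V\<close> by (simp add: V_def)
  moreover have "- a - z + a/2 = - (z + a/2)"
    by simp
  then have "\<epsilon> (- a - z) = - \<epsilon> z"
    by (simp only: \<epsilon>_def refl minus_divide_left)
  ultimately have "\<epsilon> z = - \<epsilon> z"
    using e \<open>z \<in> V\<close> by (metis image_subset_iff singletonD)
  then show False using sq[OF \<open>z \<in> V\<close>] by simp
qed

lemma deriv_bound_of_bounded:
  assumes "f holomorphic_on ball z s" "s > 0" "\<And>w. w \<in> ball z s \<Longrightarrow> cmod (f w) \<le> R"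
  shows "cmod (deriv f z) \<le> 2 * R / s"
proof -
  have sub: "cball z (s/2) \<subseteq> ball z s"
    using assms(2) by (intro subsetI) simp
  have "cmod ((deriv ^^ 1) f z) \<le> fact 1 * R / (s/2) ^ 1"
  proof (rule Cauchy_inequality)
    show "f holomorphic_on ball z (s/2)"
      using holomorphic_on_subset[OF assms(1)] sub ball_subset_cball by blast
    show "continuous_on (cball z (s/2)) f"
      by (meson assms(1) continuous_on_subset holomorphic_on_imp_continuous_on sub)
    show "cmod (f x) \<le> R" if "cmod (z - x) = s/2" for x
      using that assms(2) by (intro assms(3)) (simp add: dist_norm)
  qed (use assms in auto)
  then show ?thesis by (simp add: field_simps)
qed

text \<open>The constant depends on the bound and the radius only, so bounded families are equicontinuous.\<close>

lemma bounded_holomorphic_lipschitz: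
  assumes f: "f holomorphic_on ball z s" and s: "s > 0"
    and R: "\<And>w. w \<in> ball z s \<Longrightarrow> cmod (f w) \<le> R"
    and x: "dist z x < s/2"
  shows "cmod (f x - f z) \<le> 4 * R / s * dist z x"
proof -
  have "cmod (f x - f z) \<le> 4 * R / s * cmod (x - z)"
  proof (rule field_differentiable_bound)
    show "convex (ball z (s/2))" by simp
    fix y assume y: "y \<in> ball z (s/2)"
    have sub: "ball y (s/2) \<subseteq> ball z s"
    proof
      fix w assume "w \<in> ball y (s/2)"
      then show "w \<in> ball z s"
        using y dist_triangle[of z w y] by simp
    qed
    have "y \<in> ball z s" using y s by simp
    then show "(f has_field_derivative deriv f y) (at y within ball z (s/2))"
      by (meson f holomorphic_derivI open_ball has_field_derivative_at_within)
    have "cmod (deriv f y) \<le> 2 * R / (s/2)"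
      using sub s by (intro deriv_bound_of_bounded holomorphic_on_subset[OF f] R) auto
    then show "cmod (deriv f y) \<le> 4 * R / s" by simp
  qed (use x s in auto)
  then show ?thesis by (simp add: dist_norm norm_minus_commute)
qed

text \<open>By the maximum principle, a bound on a loop holds inside the loop, so the inside of a loop in
  the interior of \<open>K\<close> is part of it, and the loop does not wind around points elsewhere.\<close>

lemma simply_connected_interior_of_bounded_iterates:
  fixes f :: "'i \<Rightarrow> complex \<Rightarrow> complex"
  assumes hol: "\<And>n. f n holomorphic_on UNIV" and K: "K = {z. \<forall>n. cmod (f n z) \<le> R}"
    and conn: "connected (interior K)"
  shows "simply_connected (interior K)"
proof -
  have "winding_number g z = 0"
    if g: "path g" "path_image g \<subseteq> interior K" "pathfinish g = pathstart g" "z \<notin> interior K" for g z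
  proof -
    have "inside (path_image g) \<subseteq> K"
    proof
      fix x assume x: "x \<in> inside (path_image g)"
      have "cmod (f n x) \<le> R" for n
      proof (rule maximum_modulus_frontier[OF _ _ _ _ x])
        show "f n holomorphic_on interior (inside (path_image g))"
          using hol holomorphic_on_subset by blast
        show "continuous_on (closure (inside (path_image g))) (f n)"
          using hol holomorphic_on_imp_continuous_on continuous_on_subset by blast
        show "bounded (inside (path_image g))"
          by (simp add: bounded_inside bounded_path_image g(1))
        show "cmod (f n w) \<le> R" if "w \<in> frontier (inside (path_image g))" for w
          using frontier_inside_subset[OF closed_path_image[OF g(1)]] that g(2) interior_subset[of K]
          unfolding K by blast
      qed
      then show "x \<in> K" by (simp add: K)
    qed
    then have "inside (path_image g) \<subseteq> interior K"
      by (simp add: interior_maximal open_inside closed_path_image g(1))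
    then have "z \<in> outside (path_image g)"
      using g(2,4) inside_Un_outside[of "path_image g"] by blast
    then show ?thesis
      using winding_number_zero_in_outside g by blast
  qed
  then show ?thesis
    by (simp add: simply_connected_eq_winding_number_zero conn)
qed


section \<open>Fibered iterates and filled-in Julia sets\<close>

lemma fiber_iter_Suc_left:
  "fiber_iter \<alpha> l (Suc n) \<theta> z = fiber_iter \<alpha> l n (\<theta> + circle_of \<alpha>) (fiber_quad l \<theta> z)"
proof (induction n)
  case (Suc n)
  have "\<theta> + circle_of (real (Suc n) * \<alpha>) = \<theta> + circle_of \<alpha> + circle_of (real n * \<alpha>)"
    by (simp add: algebra_simps circle_of_add)
  then show ?case
    using Suc unfolding fiber_iter.simps(2) by metis
qed simp

lemma fiber_iter_add:
  "fiber_iter \<alpha> l (m + n) \<theta> z = fiber_iter \<alpha> l m (\<theta> + circle_of (real n * \<alpha>)) (fiber_iter \<alpha> l n \<theta> z)"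
proof (induction m)
  case (Suc m)
  have "\<theta> + circle_of (real (m + n) * \<alpha>) = \<theta> + circle_of (real n * \<alpha>) + circle_of (real m * \<alpha>)"
    by (simp add: algebra_simps circle_of_add)
  then show ?case
    using Suc unfolding add_Suc fiber_iter.simps(2) by metis
qed simp

lemma fiber_quad_0 [simp]: "fiber_quad l \<theta> 0 = 0"
  by (simp add: fiber_quad_def)

lemma fiber_iter_0 [simp]: "fiber_iter \<alpha> l n \<theta> 0 = 0"
  by (induction n) auto

lemma fiber_quad_holomorphic: "fiber_quad l \<theta> holomorphic_on S"
  unfolding fiber_quad_def by (intro holomorphic_intros)

lemma fiber_iter_holomorphic: "fiber_iter \<alpha> l n \<theta> holomorphic_on S"
proof (induction n)
  case 0
  have "fiber_iter \<alpha> l 0 \<theta> = (\<lambda>z. z)" by auto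
  then show ?case by (simp add: holomorphic_on_ident)
next
  case (Suc n)
  have "fiber_iter \<alpha> l (Suc n) \<theta>
      = fiber_quad l (\<theta> + circle_of (real n * \<alpha>)) \<circ> fiber_iter \<alpha> l n \<theta>"
    by auto
  then show ?case
    by (metis Suc fiber_quad_holomorphic holomorphic_on_compose)
qed

lemma fiber_iter_field_differentiable: "fiber_iter \<alpha> l n \<theta> field_differentiable at z"
  using fiber_iter_holomorphic[of \<alpha> l n \<theta> UNIV] by (auto simp: holomorphic_on_def)

lemma deriv_fiber_iter_Suc:
  "deriv (fiber_iter \<alpha> l (Suc n) \<theta>) z =
    deriv (fiber_iter \<alpha> l n (\<theta> + circle_of \<alpha>)) (fiber_quad l \<theta> z) * (2 * z + apply_bcontfun l \<theta>)"
proof -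
  have "(fiber_quad l \<theta> has_field_derivative 2 * z + apply_bcontfun l \<theta>) (at z)"
    unfolding fiber_quad_def by (auto intro!: derivative_eq_intros)
  moreover have "(fiber_iter \<alpha> l n (\<theta> + circle_of \<alpha>) has_field_derivative
      deriv (fiber_iter \<alpha> l n (\<theta> + circle_of \<alpha>)) (fiber_quad l \<theta> z)) (at (fiber_quad l \<theta> z))"
    by (simp add: field_differentiable_derivI fiber_iter_field_differentiable)
  ultimately have "((\<lambda>z. fiber_iter \<alpha> l n (\<theta> + circle_of \<alpha>) (fiber_quad l \<theta> z)) has_field_derivative
      deriv (fiber_iter \<alpha> l n (\<theta> + circle_of \<alpha>)) (fiber_quad l \<theta> z) * (2 * z + apply_bcontfun l \<theta>)) (at z)"
    using DERIV_chain2 by blast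
  moreover have "fiber_iter \<alpha> l (Suc n) \<theta> =
      (\<lambda>z. fiber_iter \<alpha> l n (\<theta> + circle_of \<alpha>) (fiber_quad l \<theta> z))"
    using fiber_iter_Suc_left by blast
  ultimately show ?thesis
    by (simp only: DERIV_imp_deriv)
qed

lemma continuous_on_eval_circle_fun:
  "continuous_on UNIV (\<lambda>p :: circle_fun \<times> circle. apply_bcontfun (fst p) (snd p))"
  unfolding continuous_on_sequentially o_def
proof safe
  fix p :: "nat \<Rightarrow> circle_fun \<times> circle" and L :: circle_fun and T :: circle
  define a where "a = (L, T)"
  assume "p \<longlonglongrightarrow> (L, T)"
  then have "p \<longlonglongrightarrow> a" by (simp add: a_def)
  then have f: "(\<lambda>n. fst (p n)) \<longlonglongrightarrow> fst a" and s: "(\<lambda>n. snd (p n)) \<longlonglongrightarrow> snd a"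
    by (rule tendsto_fst, rule tendsto_snd)
  have "(\<lambda>n. dist (fst (p n)) (fst a)) \<longlonglongrightarrow> 0"
    using f by (simp add: tendsto_dist_iff[symmetric])
  moreover have "(\<lambda>n. apply_bcontfun (fst a) (snd (p n))) \<longlonglongrightarrow> apply_bcontfun (fst a) (snd a)"
    by (rule continuous_on_tendsto_compose[OF continuous_on_apply_bcontfun[of UNIV] s]) auto
  then have "(\<lambda>n. dist (apply_bcontfun (fst a) (snd (p n))) (apply_bcontfun (fst a) (snd a))) \<longlonglongrightarrow> 0"
    by (simp add: tendsto_dist_iff[symmetric])
  ultimately have lim: "(\<lambda>n. dist (fst (p n)) (fst a) +
      dist (apply_bcontfun (fst a) (snd (p n))) (apply_bcontfun (fst a) (snd a))) \<longlonglongrightarrow> 0"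
    using tendsto_add by fastforce
  have "(\<lambda>n. dist (apply_bcontfun (fst (p n)) (snd (p n))) (apply_bcontfun (fst a) (snd a))) \<longlonglongrightarrow> 0"
  proof (rule tendsto_sandwich[OF _ _ tendsto_const lim])
    show "\<forall>\<^sub>F n in sequentially. dist (apply_bcontfun (fst (p n)) (snd (p n))) (apply_bcontfun (fst a) (snd a))
        \<le> dist (fst (p n)) (fst a) + dist (apply_bcontfun (fst a) (snd (p n))) (apply_bcontfun (fst a) (snd a))"
      by (intro always_eventually allI order_trans[OF dist_triangle add_right_mono] dist_bounded)
  qed auto
  then have "(\<lambda>n. apply_bcontfun (fst (p n)) (snd (p n))) \<longlonglongrightarrow> apply_bcontfun (fst a) (snd a)"
    using tendsto_dist_iff by blast
  then show "(\<lambda>n. apply_bcontfun (fst (p n)) (snd (p n))) \<longlonglongrightarrow> apply_bcontfun (fst (L, T)) (snd (L, T))"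
    by (simp add: a_def)
qed

lemma continuous_on_eval_circle_fun_compose [continuous_intros]:
  assumes "continuous_on S L" "continuous_on S T"
  shows "continuous_on S (\<lambda>x. apply_bcontfun (L x :: circle_fun) (T x))"
  using continuous_on_compose2[OF continuous_on_eval_circle_fun continuous_on_Pair[OF assms]] by simp

lemma continuous_on_fiber_quad [continuous_intros]:
  assumes "continuous_on S L" "continuous_on S T" "continuous_on S Z"
  shows "continuous_on S (\<lambda>x. fiber_quad (L x) (T x) (Z x))"
  unfolding fiber_quad_def by (intro continuous_intros assms)

lemma continuous_on_fiber_iter [continuous_intros]:
  assumes "continuous_on S L" "continuous_on S T" "continuous_on S Z"
  shows "continuous_on S (\<lambda>x. fiber_iter \<alpha> (L x) n (T x) (Z x))"
  by (induction n) (auto intro!: continuous_intros assms)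

lemma fiber_quad_escape:
  assumes "cmod z \<ge> norm l + 2"
  shows "cmod (fiber_quad l \<theta> z) \<ge> 2 * cmod z"
proof -
  have "cmod (z + apply_bcontfun l \<theta>) \<ge> cmod z - cmod (apply_bcontfun l \<theta>)"
    by (rule norm_diff_ineq)
  then have "cmod (z + apply_bcontfun l \<theta>) \<ge> 2"
    using norm_bounded[of l \<theta>] assms by linarith
  moreover have "fiber_quad l \<theta> z = z * (z + apply_bcontfun l \<theta>)"
    by (simp add: fiber_quad_def power2_eq_square algebra_simps)
  ultimately show ?thesis
    by (simp add: norm_mult mult.commute mult_left_mono)
qed

lemma fiber_iter_escape:
  assumes "cmod z \<ge> norm l + 2"
  shows "cmod (fiber_iter \<alpha> l n \<theta> z) \<ge> 2 ^ n * cmod z"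
proof (induction n)
  case (Suc n)
  have "cmod z \<le> 2 ^ n * cmod z"
    using mult_right_mono[of 1 "2 ^ n" "cmod z"] by simp
  then have "norm l + 2 \<le> cmod (fiber_iter \<alpha> l n \<theta> z)"
    using Suc assms by linarith
  from fiber_quad_escape[OF this, of "\<theta> + circle_of (real n * \<alpha>)"] Suc show ?case
    by simp
qed simp

lemma filled_julia_fiber_less:
  "filled_julia_fiber \<alpha> l \<theta> = {z. \<forall>n. cmod (fiber_iter \<alpha> l n \<theta> z) < norm l + 2}"
proof (intro equalityI subsetI CollectI allI)
  fix z n assume "z \<in> filled_julia_fiber \<alpha> l \<theta>"
  then obtain M where M: "\<And>n. cmod (fiber_iter \<alpha> l n \<theta> z) \<le> M"
    by (auto simp: filled_julia_fiber_def filled_julia_def bdd_above_def)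
  show "cmod (fiber_iter \<alpha> l n \<theta> z) < norm l + 2"
  proof (rule ccontr)
    let ?z = "fiber_iter \<alpha> l n \<theta> z"
    assume "\<not> ?thesis"
    then have esc: "cmod ?z \<ge> norm l + 2" by simp
    then have ge1: "1 \<le> cmod ?z" by (metis add_increasing norm_ge_zero one_le_numeral order_trans)
    obtain k where k: "2 ^ k > M"
      using real_arch_pow[of 2 M] by auto
    have "(2 :: real) ^ k * 1 \<le> 2 ^ k * cmod ?z"
      by (rule mult_left_mono[OF ge1]) simp
    then have "M < 2 ^ k * cmod ?z"
      using k by linarith
    also have "\<dots> \<le> cmod (fiber_iter \<alpha> l (k + n) \<theta> z)"
      unfolding fiber_iter_add by (rule fiber_iter_escape[OF esc])
    finally show False using M[of "k + n"] by simp
  qed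
next
  fix z assume "z \<in> {z. \<forall>n. cmod (fiber_iter \<alpha> l n \<theta> z) < norm l + 2}"
  then have "bdd_above (range (\<lambda>n. cmod (fiber_iter \<alpha> l n \<theta> z)))"
    by (auto simp: bdd_above_def intro!: exI[of _ "norm l + 2"] less_imp_le)
  then show "z \<in> filled_julia_fiber \<alpha> l \<theta>"
    by (simp add: filled_julia_fiber_def filled_julia_def)
qed

lemma filled_julia_fiberI:
  assumes "\<And>n. cmod (fiber_iter \<alpha> l n \<theta> z) \<le> M"
  shows "z \<in> filled_julia_fiber \<alpha> l \<theta>"
  using assms by (auto simp: filled_julia_fiber_def filled_julia_def bdd_above_def)

lemma filled_julia_fiber_le:
  "filled_julia_fiber \<alpha> l \<theta> = {z. \<forall>n. cmod (fiber_iter \<alpha> l n \<theta> z) \<le> norm l + 2}"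
  using filled_julia_fiberI[of \<alpha> l \<theta> _ "norm l + 2"] filled_julia_fiber_less[of \<alpha> l \<theta>]
  by (blast intro: less_imp_le)

lemma filled_julia_fiber_quad:
  "fiber_quad l \<theta> z \<in> filled_julia_fiber \<alpha> l (\<theta> + circle_of \<alpha>) \<longleftrightarrow> z \<in> filled_julia_fiber \<alpha> l \<theta>"
proof
  assume "fiber_quad l \<theta> z \<in> filled_julia_fiber \<alpha> l (\<theta> + circle_of \<alpha>)"
  then obtain M where M: "\<And>n. cmod (fiber_iter \<alpha> l (Suc n) \<theta> z) \<le> M"
    unfolding fiber_iter_Suc_left filled_julia_fiber_le by blast
  show "z \<in> filled_julia_fiber \<alpha> l \<theta>"
  proof (rule filled_julia_fiberI)
    show "cmod (fiber_iter \<alpha> l n \<theta> z) \<le> max M (cmod z)" for n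
      using M by (cases n) (auto simp del: fiber_iter.simps(2) intro: max.coboundedI1)
  qed
next
  assume "z \<in> filled_julia_fiber \<alpha> l \<theta>"
  then show "fiber_quad l \<theta> z \<in> filled_julia_fiber \<alpha> l (\<theta> + circle_of \<alpha>)"
    unfolding filled_julia_fiber_le mem_Collect_eq fiber_iter_Suc_left[symmetric] by blast
qed

lemma closed_filled_julia: "closed {(\<theta>, z). z \<in> filled_julia_fiber \<alpha> l \<theta>}"
proof -
  have "{(\<theta>, z). z \<in> filled_julia_fiber \<alpha> l \<theta>}
      = (\<Inter>n. {p. cmod (fiber_iter \<alpha> l n (fst p) (snd p)) \<le> norm l + 2})"
    by (auto simp: filled_julia_fiber_le)
  moreover have "closed \<dots>"
    by (intro closed_INT ballI closed_Collect_le continuous_intros)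
  ultimately show ?thesis by simp
qed

text \<open>The fiber is the nested intersection of the closures of the sets of points that have not
  escaped after \<open>n\<close> steps. Each of these is the quadratic preimage of such a set for \<open>n - 1\<close>
  over the next fiber, which contains the critical value because the critical orbit never escapes.\<close>

lemma connected_filled_julia_fiber:
  assumes crit: "\<And>\<theta>. - apply_bcontfun l \<theta> / 2 \<in> filled_julia_fiber \<alpha> l \<theta>"
  shows "connected (filled_julia_fiber \<alpha> l \<theta>)"
proof -
  define R where "R = norm l + 2"
  define D where "D n \<theta> = {z. cmod (fiber_iter \<alpha> l n \<theta> z) < R}" for n \<theta>
  have op: "open (D n \<theta>)" for n \<theta>
    unfolding D_def by (intro open_Collect_less continuous_intros)
  have conn: "connected (D n \<theta>)" for n \<theta>
  proof (induction n arbitrary: \<theta>)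
    case 0
    have "D 0 \<theta> = ball 0 R" by (auto simp: D_def)
    then show ?case by simp
  next
    case (Suc n)
    let ?a = "apply_bcontfun l \<theta>"
    have eq: "D (Suc n) \<theta> = {z. z\<^sup>2 + ?a * z \<in> D n (\<theta> + circle_of \<alpha>)}"
      unfolding D_def fiber_iter_Suc_left fiber_quad_def by simp
    have "- ?a / 2 \<in> D (Suc n) \<theta>"
      using crit[of \<theta>] unfolding D_def R_def filled_julia_fiber_less by blast
    then have "(- ?a / 2)\<^sup>2 + ?a * (- ?a / 2) \<in> D n (\<theta> + circle_of \<alpha>)"
      unfolding eq by simp
    then have "- (?a / 2)\<^sup>2 \<in> D n (\<theta> + circle_of \<alpha>)"
      by (simp add: power2_eq_square)
    then show ?case
      unfolding eq by (intro connected_quadratic_vimage op Suc)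
  qed
  have R_le: "cmod (fiber_iter \<alpha> l n \<theta> z) \<le> cmod (fiber_iter \<alpha> l (Suc n) \<theta> z)"
    if "R \<le> cmod (fiber_iter \<alpha> l n \<theta> z)" for n z
    using fiber_quad_escape[of l "fiber_iter \<alpha> l n \<theta> z" "\<theta> + circle_of (real n * \<alpha>)"]
      that[unfolded R_def] unfolding fiber_iter.simps(2) by (smt (verit) norm_ge_zero)
  have "D (Suc n) \<theta> \<subseteq> D n \<theta>" for n
    unfolding D_def using R_le[of n] by (intro Collect_mono impI) (meson le_less_trans not_le)
  then have nest: "D n \<theta> \<subseteq> D m \<theta>" if "m \<le> n" for m n
    using that by (rule lift_Suc_antimono_le)
  have D0: "D n \<theta> \<subseteq> ball 0 R" for n
    using nest[of 0 n] by (auto simp: D_def)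
  have cl: "closure (D n \<theta>) \<subseteq> {z. cmod (fiber_iter \<alpha> l n \<theta> z) \<le> R}" for n
  proof (rule closure_minimal)
    show "closed {z. cmod (fiber_iter \<alpha> l n \<theta> z) \<le> R}"
      by (intro closed_Collect_le continuous_intros)
  qed (auto simp: D_def)
  have "filled_julia_fiber \<alpha> l \<theta> = \<Inter> (range (\<lambda>n. closure (D n \<theta>)))"
  proof (intro equalityI)
    show "filled_julia_fiber \<alpha> l \<theta> \<subseteq> \<Inter> (range (\<lambda>n. closure (D n \<theta>)))"
      using closure_subset unfolding filled_julia_fiber_less D_def R_def by fastforce
    show "\<Inter> (range (\<lambda>n. closure (D n \<theta>))) \<subseteq> filled_julia_fiber \<alpha> l \<theta>"
      unfolding filled_julia_fiber_le using cl by (auto simp: R_def)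
  qed
  moreover have "connected (\<Inter> (range (\<lambda>n. closure (D n \<theta>))))"
  proof (rule connected_nest)
    show "compact (closure (D n \<theta>))" for n
      using bounded_subset[OF bounded_ball D0] by (simp add: compact_closure)
  qed (auto intro: connected_imp_connected_closure conn closure_mono nest subsetD[OF closure_mono[OF nest]])
  ultimately show ?thesis by simp
qed


section \<open>The basin of the invariant curve zero\<close>

definition height :: "real \<Rightarrow> circle_fun \<Rightarrow> (circle \<Rightarrow> real) \<Rightarrow> nat \<Rightarrow> circle \<Rightarrow> complex \<Rightarrow> real"
  where "height \<alpha> l w n \<theta> z = w (\<theta> + circle_of (real n * \<alpha>)) * cmod (fiber_iter \<alpha> l n \<theta> z)"

definition basin :: "real \<Rightarrow> circle_fun \<Rightarrow> (circle \<Rightarrow> real) \<Rightarrow> real \<Rightarrow> circle \<Rightarrow> complex set"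
  where "basin \<alpha> l w r \<theta> = {z. \<exists>n. height \<alpha> l w n \<theta> z < r}"

lemma height_0 [simp]: "height \<alpha> l w 0 \<theta> z = w \<theta> * cmod z"
  by (simp add: height_def)

lemma height_add:
  "height \<alpha> l w (m + n) \<theta> z = height \<alpha> l w m (\<theta> + circle_of (real n * \<alpha>)) (fiber_iter \<alpha> l n \<theta> z)"
proof -
  have "\<theta> + circle_of (real (m + n) * \<alpha>) = \<theta> + circle_of (real n * \<alpha>) + circle_of (real m * \<alpha>)"
    by (simp add: algebra_simps circle_of_add)
  then show ?thesis
    unfolding height_def fiber_iter_add by metis
qed

lemma height_Suc_left:
  "height \<alpha> l w (Suc n) \<theta> z = height \<alpha> l w n (\<theta> + circle_of \<alpha>) (fiber_quad l \<theta> z)"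
  using height_add[of \<alpha> l w n 1 \<theta> z] by simp

lemma continuous_on_height [continuous_intros]:
  assumes "continuous_on UNIV w" "continuous_on S L" "continuous_on S T" "continuous_on S Z"
  shows "continuous_on S (\<lambda>x. height \<alpha> (L x) w n (T x) (Z x))"
  unfolding height_def
  by (intro continuous_intros assms continuous_on_compose2[OF assms(1)]) auto

text \<open>A weight that makes the zero section attracting in one step, at the uniform rate \<open>\<kappa>\<close> on
  the region of height at most \<open>r\<close>. With constant weights many iterates may be necessary
  before the contraction shows.\<close>

locale attracting_weight =
  fixes \<alpha> :: real and l :: circle_fun and w :: "circle \<Rightarrow> real" and \<kappa> r :: real
  assumes w_cont: "continuous_on UNIV w" and w_pos: "\<And>\<theta>. w \<theta> > 0"
    and r_pos: "r > 0" and \<kappa>: "0 \<le> \<kappa>" "\<kappa> < 1"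
    and contract: "\<And>\<theta> z. w \<theta> * cmod z \<le> r \<Longrightarrow>
      w (\<theta> + circle_of \<alpha>) * cmod (fiber_quad l \<theta> z) \<le> \<kappa> * (w \<theta> * cmod z)"
begin

abbreviation K :: "circle \<Rightarrow> complex set" where "K \<equiv> filled_julia_fiber \<alpha> l"
abbreviation H :: "nat \<Rightarrow> circle \<Rightarrow> complex \<Rightarrow> real" where "H \<equiv> height \<alpha> l w"
abbreviation B :: "circle \<Rightarrow> complex set" where "B \<equiv> basin \<alpha> l w r"
abbreviation crit :: "circle \<Rightarrow> complex" where "crit \<theta> \<equiv> - apply_bcontfun l \<theta> / 2"

lemma w_bounds: obtains m M where "m > 0" "\<And>\<theta>. m \<le> w \<theta>" "M > 0" "\<And>\<theta>. w \<theta> \<le> M"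
proof -
  obtain a where a: "\<And>\<theta>. w a \<le> w \<theta>"
    using continuous_attains_inf[OF compact_UNIV_circle UNIV_not_empty w_cont] by auto
  obtain b where b: "\<And>\<theta>. w \<theta> \<le> w b"
    using continuous_attains_sup[OF compact_UNIV_circle UNIV_not_empty w_cont] by auto
  show ?thesis using that[OF w_pos a w_pos b] .
qed

lemma height_nonneg: "H n \<theta> z \<ge> 0"
  using w_pos[of "\<theta> + circle_of (real n * \<alpha>)"] by (simp add: height_def)

lemma height_Suc_le:
  assumes "H n \<theta> z \<le> r"
  shows "H (Suc n) \<theta> z \<le> \<kappa> * H n \<theta> z"
proof -
  have "\<theta> + circle_of (real (Suc n) * \<alpha>) = \<theta> + circle_of (real n * \<alpha>) + circle_of \<alpha>"
    by (simp add: algebra_simps circle_of_add)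
  then show ?thesis
    using contract[of "\<theta> + circle_of (real n * \<alpha>)" "fiber_iter \<alpha> l n \<theta> z"] assms
    by (simp add: height_def algebra_simps)
qed

lemma height_decay:
  assumes "H n \<theta> z \<le> r"
  shows "H (k + n) \<theta> z \<le> \<kappa> ^ k * H n \<theta> z"
proof (induction k)
  case (Suc k)
  have "\<kappa> ^ k * H n \<theta> z \<le> 1 * r"
    using \<kappa> assms r_pos height_nonneg by (intro mult_mono power_le_one) auto
  then have "H (k + n) \<theta> z \<le> r"
    using Suc by simp
  then have "H (Suc (k + n)) \<theta> z \<le> \<kappa> * H (k + n) \<theta> z"
    by (rule height_Suc_le)
  also have "\<dots> \<le> \<kappa> * (\<kappa> ^ k * H n \<theta> z)"
    using Suc \<kappa> by (intro mult_left_mono)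
  finally show ?case by simp
qed simp

lemma height_antimono:
  assumes "H n \<theta> z \<le> r" "n \<le> m"
  shows "H m \<theta> z \<le> H n \<theta> z"
proof -
  have "\<kappa> ^ (m - n) * H n \<theta> z \<le> 1 * H n \<theta> z"
    using \<kappa> height_nonneg by (intro mult_right_mono power_le_one) auto
  then show ?thesis
    using height_decay[OF assms(1), of "m - n"] assms(2) by simp
qed

lemma height_eventually_less:
  assumes "z \<in> B \<theta>" "e > 0"
  obtains N where "\<And>n. n \<ge> N \<Longrightarrow> H n \<theta> z < e"
proof -
  obtain n where n: "H n \<theta> z < r" using assms(1) by (auto simp: basin_def)
  obtain k where k: "\<kappa> ^ k < min e r / r"
    using real_arch_pow_inv[of "min e r / r" \<kappa>] \<kappa> r_pos assms(2) by auto
  have "H (k + n) \<theta> z \<le> \<kappa> ^ k * H n \<theta> z"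
    using n by (intro height_decay) simp
  also have "\<dots> \<le> \<kappa> ^ k * r"
    using n \<kappa> by (intro mult_left_mono) auto
  also have "\<dots> < min e r"
    using k r_pos by (simp add: field_simps)
  finally have less: "H (k + n) \<theta> z < e" "H (k + n) \<theta> z < r" by simp_all
  show ?thesis
  proof (rule that)
    show "H m \<theta> z < e" if "m \<ge> k + n" for m
      using height_antimono[OF less_imp_le[OF less(2)] that] less(1) by simp
  qed
qed

lemma basinI: "H n \<theta> z < r \<Longrightarrow> z \<in> B \<theta>"
  by (auto simp: basin_def)

lemma basinI_le:
  assumes "H n \<theta> z \<le> r" shows "z \<in> B \<theta>"
proof -
  have "H (Suc n) \<theta> z \<le> \<kappa> * H n \<theta> z" using height_Suc_le[OF assms] .
  also have "\<dots> \<le> \<kappa> * r" using assms \<kappa> by (intro mult_left_mono)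
  also have "\<dots> < r" using \<kappa> r_pos by simp
  finally show ?thesis by (rule basinI)
qed

lemma basin_eventually:
  assumes "z \<in> B \<theta>"
  obtains N where "\<And>n. n \<ge> N \<Longrightarrow> H n \<theta> z < r"
  using height_eventually_less[OF assms r_pos] by blast

lemma fiber_quad_in_basin: "fiber_quad l \<theta> z \<in> B (\<theta> + circle_of \<alpha>) \<longleftrightarrow> z \<in> B \<theta>"
proof
  assume "fiber_quad l \<theta> z \<in> B (\<theta> + circle_of \<alpha>)"
  then show "z \<in> B \<theta>"
    unfolding basin_def mem_Collect_eq height_Suc_left[symmetric] by blast
next
  assume "z \<in> B \<theta>"
  then obtain N where "\<And>n. n \<ge> N \<Longrightarrow> H n \<theta> z < r" using basin_eventually by blast
  then have "H (Suc N) \<theta> z < r" by simp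
  then show "fiber_quad l \<theta> z \<in> B (\<theta> + circle_of \<alpha>)"
    unfolding height_Suc_left by (rule basinI)
qed

lemma zero_in_basin: "0 \<in> B \<theta>"
  using r_pos by (auto simp: basin_def height_def)

lemma open_basin_total: "open {(\<theta>, z). z \<in> B \<theta>}"
proof -
  have "{(\<theta>, z). z \<in> B \<theta>} = (\<Union>n. {p. H n (fst p) (snd p) < r})"
    by (auto simp: basin_def)
  moreover have "open \<dots>"
    by (intro open_UN ballI open_Collect_less continuous_intros w_cont)
  ultimately show ?thesis by simp
qed

lemma open_basin: "open (B \<theta>)"
proof -
  have "open ((\<lambda>z. (\<theta>, z)) -` {(\<theta>, z). z \<in> B \<theta>})"
    by (intro open_vimage open_basin_total continuous_intros)
  then show ?thesis by (simp add: vimage_def)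
qed

lemma basin_subset_filled_julia: "B \<theta> \<subseteq> K \<theta>"
proof
  fix z assume "z \<in> B \<theta>"
  then obtain N where N: "\<And>n. n \<ge> N \<Longrightarrow> H n \<theta> z < r" using basin_eventually by blast
  obtain m where m: "m > 0" "\<And>\<theta>. m \<le> w \<theta>" using w_bounds by metis
  have late: "cmod (fiber_iter \<alpha> l n \<theta> z) \<le> r / m" if "n \<ge> N" for n
  proof -
    have "m * cmod (fiber_iter \<alpha> l n \<theta> z) \<le> H n \<theta> z"
      unfolding height_def by (intro mult_right_mono m) simp
    then show ?thesis
      using N[OF that] m(1) by (simp add: field_simps)
  qed
  show "z \<in> K \<theta>"
  proof (rule filled_julia_fiberI)
    fix n
    show "cmod (fiber_iter \<alpha> l n \<theta> z) \<le> Max (insert (r / m) ((\<lambda>n. cmod (fiber_iter \<alpha> l n \<theta> z)) ` {..<N}))"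
    proof (cases "n < N")
      case False
      then have "cmod (fiber_iter \<alpha> l n \<theta> z) \<le> r / m" using late by simp
      also have "\<dots> \<le> Max (insert (r / m) ((\<lambda>n. cmod (fiber_iter \<alpha> l n \<theta> z)) ` {..<N}))"
        by (intro Max_ge) auto
      finally show ?thesis .
    qed (intro Max_ge; auto)
  qed
qed

text \<open>The component of \<open>0\<close> in the basin pulls back to the component of \<open>0\<close> in the previous
  fiber: it contains the critical value, so its preimage is connected, and the preimage contains
  \<open>0\<close>. Every basin point reaches a small disc around \<open>0\<close>, which lies in the component, and
  pulling back along its orbit shows that the point itself does.\<close>

lemma connected_basin:
  assumes joined: "\<And>\<theta>. \<exists>\<Gamma>. connected \<Gamma> \<and> 0 \<in> \<Gamma> \<and> crit \<theta> \<in> \<Gamma> \<and> \<Gamma> \<subseteq> B \<theta>"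
  shows "connected (B \<theta>)"
proof -
  define I where "I \<theta> = connected_component_set (B \<theta>) 0" for \<theta>
  have I_max: "C \<subseteq> I \<theta>" if "connected C" "0 \<in> C" "C \<subseteq> B \<theta>" for C \<theta>
    unfolding I_def by (intro connected_component_maximal that)
  have zero: "0 \<in> I \<theta>" for \<theta>
    by (simp add: I_def zero_in_basin)
  have pull: "z \<in> I \<theta>" if z: "fiber_quad l \<theta> z \<in> I (\<theta> + circle_of \<alpha>)" for z \<theta>
  proof -
    let ?a = "apply_bcontfun l \<theta>"
    obtain \<Gamma> where \<Gamma>: "connected \<Gamma>" "0 \<in> \<Gamma>" "crit \<theta> \<in> \<Gamma>" "\<Gamma> \<subseteq> B \<theta>"
      using joined by blast
    have "fiber_quad l \<theta> ` \<Gamma> \<subseteq> I (\<theta> + circle_of \<alpha>)"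
    proof (rule I_max)
      show "connected (fiber_quad l \<theta> ` \<Gamma>)"
        by (intro connected_continuous_image \<Gamma> continuous_intros)
      show "0 \<in> fiber_quad l \<theta> ` \<Gamma>"
        using \<Gamma>(2) by (metis fiber_quad_0 image_eqI)
      show "fiber_quad l \<theta> ` \<Gamma> \<subseteq> B (\<theta> + circle_of \<alpha>)"
        using \<Gamma>(4) by (auto simp: fiber_quad_in_basin)
    qed
    then have "fiber_quad l \<theta> (crit \<theta>) \<in> I (\<theta> + circle_of \<alpha>)"
      using \<Gamma>(3) by blast
    then have "- (?a / 2)\<^sup>2 \<in> I (\<theta> + circle_of \<alpha>)"
      by (simp add: fiber_quad_def power2_eq_square)
    then have "connected {z. z\<^sup>2 + ?a * z \<in> I (\<theta> + circle_of \<alpha>)}"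
      unfolding I_def
      by (intro connected_quadratic_vimage open_connected_component open_basin connected_connected_component)
    moreover have "{z. fiber_quad l \<theta> z \<in> I (\<theta> + circle_of \<alpha>)} \<subseteq> B \<theta>"
      using connected_component_subset fiber_quad_in_basin unfolding I_def by blast
    moreover have "0 \<in> {z. fiber_quad l \<theta> z \<in> I (\<theta> + circle_of \<alpha>)}"
      by (simp add: zero)
    ultimately have "{z. fiber_quad l \<theta> z \<in> I (\<theta> + circle_of \<alpha>)} \<subseteq> I \<theta>"
      unfolding fiber_quad_def by (intro I_max)
    then show ?thesis using z by blast
  qed
  have pull_n: "z \<in> I \<theta>" if "fiber_iter \<alpha> l n \<theta> z \<in> I (\<theta> + circle_of (real n * \<alpha>))" for n \<theta> z
    using that
  proof (induction n arbitrary: \<theta> z)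
    case (Suc n)
    have "\<theta> + circle_of (real (Suc n) * \<alpha>) = \<theta> + circle_of \<alpha> + circle_of (real n * \<alpha>)"
      by (simp add: algebra_simps circle_of_add)
    then show ?case
      using Suc by (metis fiber_iter_Suc_left pull)
  qed simp
  have "B \<theta> \<subseteq> I \<theta>"
  proof
    fix z assume "z \<in> B \<theta>"
    then obtain n where n: "H n \<theta> z < r" by (auto simp: basin_def)
    let ?\<theta> = "\<theta> + circle_of (real n * \<alpha>)"
    have "ball 0 (r / w ?\<theta>) \<subseteq> I ?\<theta>"
    proof (rule I_max)
      show "ball 0 (r / w ?\<theta>) \<subseteq> B ?\<theta>"
      proof
        fix x :: complex assume "x \<in> ball 0 (r / w ?\<theta>)"
        then have "H 0 ?\<theta> x < r"
          using w_pos[of ?\<theta>] by (simp add: field_simps)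
        then show "x \<in> B ?\<theta>" by (rule basinI)
      qed
    qed (use r_pos w_pos in auto)
    moreover have "fiber_iter \<alpha> l n \<theta> z \<in> ball 0 (r / w ?\<theta>)"
      using n w_pos[of ?\<theta>] by (simp add: height_def field_simps)
    ultimately show "z \<in> I \<theta>" using pull_n by blast
  qed
  then have "B \<theta> = I \<theta>"
    using connected_component_subset unfolding I_def by blast
  then show ?thesis
    unfolding I_def by (metis connected_connected_component)
qed

end


section \<open>Expansion off the basin\<close>

context attracting_weight
begin

lemma critical_points_common_time:
  assumes crit: "\<And>\<theta>. crit \<theta> \<in> B \<theta>"
  obtains m where "\<And>\<theta>. H m \<theta> (crit \<theta>) < r"
proof -
  define U where "U n = {\<theta>. H n \<theta> (crit \<theta>) < r}" for n
  have op: "open (U n)" for n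
    unfolding U_def by (intro open_Collect_less continuous_intros w_cont) auto
  have cover: "UNIV \<subseteq> (\<Union>n. U n)"
    using crit by (auto simp: U_def basin_def)
  obtain N where N: "finite N" "UNIV \<subseteq> (\<Union>n\<in>N. U n)"
    by (rule compactE_image[OF compact_UNIV_circle op cover])
  show ?thesis
  proof
    fix \<theta>
    have "\<theta> \<in> (\<Union>n\<in>N. U n)" using N(2) by blast
    then obtain n where n: "n \<in> N" "H n \<theta> (crit \<theta>) < r" by (auto simp: U_def)
    then show "H (Max N) \<theta> (crit \<theta>) < r"
      using height_antimono[of n \<theta> "crit \<theta>" "Max N"] N(1) by simp
  qed
qed

text \<open>Points of bounded height after a common time \<open>m\<close> are removed from the disc of escape radius,
  where \<open>m\<close> is chosen such that the critical values are among the removed points. Holomorphic discs in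
  the remaining region \<open>S\<close> lift through the quadratic maps. The lifts stay in a compact subset
  \<open>C\<close> of \<open>S\<close>, hence at distance \<open>\<eta>\<close> from its boundary, and remain in \<open>S\<close> when
  scaled about their center by \<open>1 + \<delta>\<close>. After \<open>n\<close> lifts the derivative has gained
  \<open>(1 + \<delta>) ^ n\<close> divided by the derivative of the iterate, and it is still bounded by the size
  of \<open>S\<close>. This is the strict contraction of the Kobayashi metric under inverse branches.\<close>

lemma expansion_off_basin:
  assumes crit: "\<And>\<theta>. crit \<theta> \<in> B \<theta>"
  shows "\<exists>A>0. \<exists>\<sigma>>1. \<forall>\<theta> n. \<forall>z \<in> K \<theta> - B \<theta>.
    cmod (deriv (fiber_iter \<alpha> l n \<theta>) z) \<ge> A * \<sigma> ^ n"
proof -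
  define R where "R = norm l + 2"
  have R: "R > 0" by (simp add: R_def add_nonneg_pos)
  obtain m where m: "\<And>\<theta>. H m \<theta> (crit \<theta>) < r"
    using critical_points_common_time[OF crit] by blast
  define S where "S = {p. cmod (snd p) < R \<and> r < H m (fst p) (snd p)}"
  \<comment> \<open>The lifts of discs in \<open>S\<close> lie in \<open>C\<close>: one more step of the dynamics turns the strict
    inequalities of \<open>S\<close> into the weak ones of \<open>C\<close>.\<close>
  define C where "C = {p. cmod (snd p) \<le> R \<and> cmod (fiber_quad l (fst p) (snd p)) \<le> R
    \<and> r \<le> H (Suc m) (fst p) (snd p)}"
  have "open S"
    unfolding S_def by (intro open_Collect_conj open_Collect_less continuous_intros w_cont)
  have "closed C"
    unfolding C_def by (intro closed_Collect_conj closed_Collect_le continuous_intros w_cont)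
  moreover have "C \<subseteq> UNIV \<times> cball 0 R"
    by (auto simp: C_def)
  ultimately have "compact C"
    by (metis compact_Int_closed compact_Times compact_UNIV_circle compact_cball inf.absorb2)
  have "C \<subseteq> S"
  proof
    fix p assume p: "p \<in> C"
    have "cmod (snd p) < R"
    proof (rule ccontr)
      assume "\<not> ?thesis"
      then show False
        using fiber_quad_escape[of l "snd p" "fst p"] p R by (simp add: C_def R_def)
    qed
    moreover have "r < H m (fst p) (snd p)"
    proof (rule ccontr)
      assume "\<not> ?thesis"
      then have le: "H m (fst p) (snd p) \<le> r" by simp
      have "H (Suc m) (fst p) (snd p) \<le> \<kappa> * H m (fst p) (snd p)"
        using le by (rule height_Suc_le)
      also have "\<dots> \<le> \<kappa> * r"
        using le \<kappa> by (intro mult_left_mono)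
      also have "\<dots> < r" using \<kappa> r_pos by simp
      finally show False using p by (simp add: C_def)
    qed
    ultimately show "p \<in> S" by (simp add: S_def)
  qed
  then obtain \<eta> where \<eta>: "\<eta> > 0" "\<forall>x\<in>C. \<forall>y\<in>- S. \<eta> \<le> dist x y"
    using separate_compact_closed[OF \<open>compact C\<close>, of "- S"] \<open>open S\<close> by auto
  have S_near: "(\<theta>, z') \<in> S" if "(\<theta>, z) \<in> C" "dist z z' < \<eta>" for \<theta> z z'
    using \<eta>(2)[rule_format, OF that(1), of "(\<theta>, z')"] that(2) by (fastforce simp: dist_Pair_Pair)
  \<comment> \<open>Two points of the disc of radius \<open>R\<close> are less than \<open>2 * R\<close> apart, so scaling by
    \<open>1 + \<delta>\<close> moves them by less than \<open>\<eta>\<close>.\<close>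
  define \<delta> where "\<delta> = \<eta> / (2 * R)"
  have \<delta>: "\<delta> > 0" using \<eta>(1) R by (simp add: \<delta>_def)
  have L: "(\<theta>, z) \<in> C" if "z \<in> K \<theta> - B \<theta>" for \<theta> z
  proof -
    have "cmod (fiber_iter \<alpha> l 0 \<theta> z) < R" "cmod (fiber_iter \<alpha> l (Suc 0) \<theta> z) < R"
      using that unfolding filled_julia_fiber_less R_def by blast+
    moreover have "\<not> H (Suc m) \<theta> z \<le> r"
      using basinI_le that by blast
    ultimately show ?thesis by (simp add: C_def)
  qed
  have crit_value: "(\<theta> + circle_of \<alpha>, - (apply_bcontfun l \<theta> / 2)\<^sup>2) \<notin> S" for \<theta>
  proof -
    have "H m (\<theta> + circle_of \<alpha>) (fiber_quad l \<theta> (crit \<theta>)) \<le> H m \<theta> (crit \<theta>)"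
      unfolding height_Suc_left[symmetric] using m[of \<theta>] by (intro height_antimono) auto
    moreover have "fiber_quad l \<theta> (crit \<theta>) = - (apply_bcontfun l \<theta> / 2)\<^sup>2"
      by (simp add: fiber_quad_def power2_eq_square)
    ultimately show ?thesis
      using m[of \<theta>] by (simp add: S_def)
  qed
  have discs: "\<exists>g. g holomorphic_on ball 0 1 \<and> g 0 = z \<and> (\<forall>\<zeta>\<in>ball 0 1. (\<theta>, g \<zeta>) \<in> S) \<and>
      cmod (deriv g 0) * cmod (deriv (fiber_iter \<alpha> l n \<theta>) z) = \<eta> * (1 + \<delta>) ^ n"
    if "z \<in> K \<theta> - B \<theta>" for n \<theta> z
    using that
  proof (induction n arbitrary: \<theta> z)
    case 0
    \<comment> \<open>The initial disc has radius \<open>\<eta>\<close> around \<open>z\<close>, which is itself a point of \<open>C\<close>.\<close>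
    let ?g = "\<lambda>\<zeta>. z + of_real \<eta> * \<zeta>"
    have "(?g has_field_derivative of_real \<eta>) (at 0)"
      by (auto intro!: derivative_eq_intros)
    then have "deriv ?g 0 = of_real \<eta>" by (rule DERIV_imp_deriv)
    moreover have "fiber_iter \<alpha> l 0 \<theta> = (\<lambda>z. z)" by auto
    then have "deriv (fiber_iter \<alpha> l 0 \<theta>) z = 1" by simp
    moreover have "(\<theta>, ?g \<zeta>) \<in> S" if "\<zeta> \<in> ball 0 1" for \<zeta>
      using that \<eta>(1) by (intro S_near[OF L[OF 0]]) (simp add: dist_norm norm_mult)
    moreover have "?g holomorphic_on ball 0 1"
      by (intro holomorphic_intros)
    ultimately show ?case using \<eta>(1) by (intro exI[of _ ?g]) simp
  next
    case (Suc n)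
    let ?\<theta> = "\<theta> + circle_of \<alpha>" and ?a = "apply_bcontfun l \<theta>"
    have "fiber_quad l \<theta> z \<in> K ?\<theta> - B ?\<theta>"
      using Suc.prems by (simp add: filled_julia_fiber_quad fiber_quad_in_basin)
    from Suc.IH[OF this] obtain g where g: "g holomorphic_on ball 0 1" "g 0 = fiber_quad l \<theta> z"
      "\<And>\<zeta>. \<zeta> \<in> ball 0 1 \<Longrightarrow> (?\<theta>, g \<zeta>) \<in> S"
      "cmod (deriv g 0) * cmod (deriv (fiber_iter \<alpha> l n ?\<theta>) (fiber_quad l \<theta> z)) = \<eta> * (1 + \<delta>) ^ n"
      by blast
    have omit: "- (?a / 2)\<^sup>2 \<notin> g ` ball 0 1"
      using crit_value[of \<theta>] g(3) by (metis imageE)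
    obtain h where h: "h holomorphic_on ball 0 1" "h 0 = z"
        "\<And>\<zeta>. \<zeta> \<in> ball 0 1 \<Longrightarrow> (h \<zeta>)\<^sup>2 + ?a * h \<zeta> = g \<zeta>"
      by (rule quadratic_lift[of "ball 0 1" 0 g ?a z])
         (use g(1,2) omit in \<open>auto simp: fiber_quad_def\<close>)
    have hC: "(\<theta>, h \<zeta>) \<in> C" if \<zeta>: "\<zeta> \<in> ball 0 1" for \<zeta>
    proof -
      have q: "fiber_quad l \<theta> (h \<zeta>) = g \<zeta>"
        using h(3)[OF \<zeta>] by (simp add: fiber_quad_def)
      then have "cmod (fiber_quad l \<theta> (h \<zeta>)) < R" "r < H (Suc m) \<theta> (h \<zeta>)"
        using g(3)[OF \<zeta>] by (simp_all add: S_def height_Suc_left)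
      moreover have "cmod (h \<zeta>) \<le> R"
        using fiber_quad_escape[of l "h \<zeta>" \<theta>] calculation(1) R unfolding R_def by linarith
      ultimately show ?thesis by (simp add: C_def)
    qed
    \<comment> \<open>The lift, scaled about its center \<open>z\<close> by the factor \<open>1 + \<delta>\<close>.\<close>
    define f where "f \<zeta> = h \<zeta> + of_real \<delta> * (h \<zeta> - z)" for \<zeta>
    have h': "(h has_field_derivative deriv h 0) (at 0)"
      using h(1) by (simp add: holomorphic_derivI)
    have "(f has_field_derivative (1 + of_real \<delta>) * deriv h 0) (at 0)"
      unfolding f_def by (auto intro!: derivative_eq_intros h' simp: algebra_simps)
    then have f': "deriv f 0 = (1 + of_real \<delta>) * deriv h 0"
      by (rule DERIV_imp_deriv)
    have "((\<lambda>\<zeta>. (h \<zeta>)\<^sup>2 + ?a * h \<zeta>) has_field_derivative (2 * z + ?a) * deriv h 0) (at 0)"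
      by (auto intro!: derivative_eq_intros h' simp: h(2) algebra_simps)
    then have "(g has_field_derivative (2 * z + ?a) * deriv h 0) (at 0)"
      by (rule has_field_derivative_transform_within_open[of _ _ _ "ball 0 1"]) (auto simp: h(3))
    then have g': "deriv g 0 = (2 * z + ?a) * deriv h 0"
      by (rule DERIV_imp_deriv)
    have "cmod (deriv f 0) * cmod (deriv (fiber_iter \<alpha> l (Suc n) \<theta>) z)
        = (1 + \<delta>) * (cmod (deriv g 0) * cmod (deriv (fiber_iter \<alpha> l n ?\<theta>) (fiber_quad l \<theta> z)))"
    proof -
      have "cmod (1 + of_real \<delta>) = 1 + \<delta>"
        using \<delta> by (metis norm_of_real of_real_1 of_real_add abs_of_nonneg add_nonneg_nonneg less_imp_le zero_le_one)
      then show ?thesis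
        unfolding f' g' deriv_fiber_iter_Suc by (simp add: norm_mult)
    qed
    also have "\<dots> = \<eta> * (1 + \<delta>) ^ Suc n"
      unfolding g(4) by simp
    finally have "cmod (deriv f 0) * cmod (deriv (fiber_iter \<alpha> l (Suc n) \<theta>) z) = \<eta> * (1 + \<delta>) ^ Suc n" .
    moreover have "(\<theta>, f \<zeta>) \<in> S" if \<zeta>: "\<zeta> \<in> ball 0 1" for \<zeta>
    proof (rule S_near[OF hC[OF \<zeta>]])
      have "cmod z < R"
        using L[OF Suc.prems] \<open>C \<subseteq> S\<close> by (auto simp: S_def)
      moreover have "cmod (h \<zeta>) \<le> R"
        using hC[OF \<zeta>] by (simp add: C_def)
      ultimately have "cmod (h \<zeta> - z) < 2 * R"
        using norm_triangle_ineq4[of "h \<zeta>" z] by linarith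
      then have "\<delta> * cmod (h \<zeta> - z) < \<delta> * (2 * R)"
        using \<delta> by (rule mult_strict_left_mono)
      moreover have "dist (h \<zeta>) (f \<zeta>) = \<delta> * cmod (h \<zeta> - z)"
        using \<delta> by (simp add: f_def dist_norm norm_mult)
      moreover have "\<delta> * (2 * R) = \<eta>"
        using R by (simp add: \<delta>_def)
      ultimately show "dist (h \<zeta>) (f \<zeta>) < \<eta>"
        by simp
    qed
    moreover have "f holomorphic_on ball 0 1"
      unfolding f_def by (intro holomorphic_intros h)
    moreover have "f 0 = z"
      by (simp add: f_def h(2))
    ultimately show ?case
      by (intro exI[of _ f] conjI ballI)
  qed
  have "\<eta> / (2 * R) * (1 + \<delta>) ^ n \<le> cmod (deriv (fiber_iter \<alpha> l n \<theta>) z)"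
    if z: "z \<in> K \<theta> - B \<theta>" for n \<theta> z
  proof -
    obtain g where g: "g holomorphic_on ball 0 1" "\<And>\<zeta>. \<zeta> \<in> ball 0 1 \<Longrightarrow> (\<theta>, g \<zeta>) \<in> S"
      "cmod (deriv g 0) * cmod (deriv (fiber_iter \<alpha> l n \<theta>) z) = \<eta> * (1 + \<delta>) ^ n"
      using discs[OF z] by blast
    have "cmod (deriv g 0) \<le> 2 * R / 1"
      using g(2) by (intro deriv_bound_of_bounded g(1)) (auto simp: S_def intro: less_imp_le)
    then have "\<eta> * (1 + \<delta>) ^ n \<le> 2 * R * cmod (deriv (fiber_iter \<alpha> l n \<theta>) z)"
      unfolding g(3)[symmetric] by (intro mult_right_mono) auto
    then show ?thesis
      using R by (simp add: field_simps)
  qed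
  then show ?thesis
    using \<eta>(1) R \<delta> by (intro exI[of _ "\<eta> / (2 * R)"] exI[of _ "1 + \<delta>"] conjI allI ballI) auto
qed

text \<open>At an interior point, Cauchy's estimate bounds the derivatives of all iterates, which excludes
  expansion.\<close>

lemma interior_filled_julia_eq_basin:
  assumes crit: "\<And>\<theta>. crit \<theta> \<in> B \<theta>"
  shows "interior (K \<theta>) = B \<theta>"
proof
  show "B \<theta> \<subseteq> interior (K \<theta>)"
    by (intro interior_maximal basin_subset_filled_julia open_basin)
  show "interior (K \<theta>) \<subseteq> B \<theta>"
  proof (rule subsetI, rule ccontr)
    fix z assume z: "z \<in> interior (K \<theta>)" "z \<notin> B \<theta>"
    have "z \<in> K \<theta> - B \<theta>"
      using z interior_subset by blast
    with expansion_off_basin[OF crit] obtain A \<sigma> where A: "A > 0" "\<sigma> > 1"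
      "\<And>n. cmod (deriv (fiber_iter \<alpha> l n \<theta>) z) \<ge> A * \<sigma> ^ n"
      by meson
    obtain s where s: "s > 0" "ball z s \<subseteq> K \<theta>"
      using z(1) by (auto simp: mem_interior)
    have "cmod (deriv (fiber_iter \<alpha> l n \<theta>) z) \<le> 2 * (norm l + 2) / s" for n
      using s by (intro deriv_bound_of_bounded fiber_iter_holomorphic)
        (auto simp: filled_julia_fiber_le)
    then have le: "A * \<sigma> ^ n \<le> 2 * (norm l + 2) / s" for n
      using A(3) order_trans by blast
    obtain n where "\<sigma> ^ n > 2 * (norm l + 2) / s / A"
      using real_arch_pow[OF A(2)] by blast
    then show False
      using le[of n] pos_divide_less_eq[OF A(1), of "2 * (norm l + 2) / s" "\<sigma> ^ n"]
        mult.commute[of A "\<sigma> ^ n"] by linarith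
  qed
qed

text \<open>The Julia set is a closure in the product of the circle and the plane. It stays off the basin, as
  the filled-in Julia set is closed and the basin is open in this product, so expansion off the basin
  is hyperbolicity.\<close>

lemma main_cardioid_of_joined:
  assumes joined: "\<And>\<theta>. \<exists>\<Gamma>. connected \<Gamma> \<and> 0 \<in> \<Gamma> \<and> crit \<theta> \<in> \<Gamma> \<and> \<Gamma> \<subseteq> B \<theta>"
  shows "l \<in> main_cardioid \<alpha>"
proof -
  have crit: "crit \<theta> \<in> B \<theta>" for \<theta>
    using joined[of \<theta>] by auto
  have int: "interior (K \<theta>) = B \<theta>" for \<theta>
    by (rule interior_filled_julia_eq_basin[OF crit])
  have julia: "julia \<alpha> l \<subseteq> {(\<theta>, z). z \<in> K \<theta> - B \<theta>}"
    unfolding julia_def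
  proof (rule closure_minimal)
    have eq: "{(\<theta>, z). z \<in> K \<theta> - B \<theta>} = {(\<theta>, z). z \<in> K \<theta>} - {(\<theta>, z). z \<in> B \<theta>}"
      by auto
    show "closed {(\<theta>, z). z \<in> K \<theta> - B \<theta>}"
      unfolding eq by (intro closed_Diff closed_filled_julia open_basin_total)
    have "closed (K \<theta>)" for \<theta>
    proof -
      have "closed ((\<lambda>z. (\<theta>, z)) -` {(\<theta>, z). z \<in> K \<theta>})"
        by (intro closed_vimage closed_filled_julia continuous_intros)
      then show ?thesis by (simp add: vimage_def)
    qed
    then show "(SIGMA \<theta>:UNIV. frontier (K \<theta>)) \<subseteq> {(\<theta>, z). z \<in> K \<theta> - B \<theta>}"
      by (auto simp: frontier_def int)
  qed
  have "hyperbolic \<alpha> l"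
  proof -
    obtain A \<sigma> where A: "A > 0" "\<sigma> > 1"
      "\<forall>\<theta> n. \<forall>z \<in> K \<theta> - B \<theta>. cmod (deriv (fiber_iter \<alpha> l n \<theta>) z) \<ge> A * \<sigma> ^ n"
      using expansion_off_basin[OF crit] by auto
    then have "\<forall>(\<theta>, z) \<in> julia \<alpha> l. \<forall>n. cmod (deriv (fiber_iter \<alpha> l n \<theta>) z) \<ge> A * \<sigma> ^ n"
      using julia by auto
    then show ?thesis
      unfolding hyperbolic_def using A(1,2) by auto
  qed
  moreover have "connected (K \<theta>)" for \<theta>
    using crit basin_subset_filled_julia by (intro connected_filled_julia_fiber) blast
  moreover have "connected (interior (K \<theta>)) \<and> interior (K \<theta>) \<noteq> {}" for \<theta>
    unfolding int using connected_basin[OF joined] zero_in_basin by blast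
  ultimately show ?thesis
    by (simp add: main_cardioid_def connectedness_locus_def)
qed

text \<open>The iterates are equicontinuous on the interior, so a point of it close to the basin shadows a
  basin orbit well enough to enter the region of attraction itself. Hence the basin is closed
  relative to the interior.\<close>

lemma basin_eq_interior_of_connected:
  assumes conn: "connected (interior (K \<theta>))"
  shows "B \<theta> = interior (K \<theta>)"
proof -
  let ?U = "interior (K \<theta>)"
  define R where "R = norm l + 2"
  have R: "R > 0" by (simp add: R_def add_nonneg_pos)
  obtain M where M: "M > 0" "\<And>\<theta>. w \<theta> \<le> M" using w_bounds by metis
  have sub: "B \<theta> \<subseteq> ?U"
    by (intro interior_maximal basin_subset_filled_julia open_basin)
  have "open (?U - B \<theta>)"
    unfolding open_contains_ball
  proof
    fix z assume z: "z \<in> ?U - B \<theta>"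
    obtain s where s: "s > 0" "ball z s \<subseteq> ?U"
      using z open_interior open_contains_ball by blast
    \<comment> \<open>With the Lipschitz constant \<open>4 * R / s\<close>, this allows an error in height of at most
      \<open>r / 2\<close>.\<close>
    define d where "d = min (s / 2) (r * s / (8 * R * M))"
    have d: "d > 0" using s(1) r_pos R M(1) by (simp add: d_def)
    have "x \<notin> B \<theta>" if x: "x \<in> ball z d" for x
    proof
      assume "x \<in> B \<theta>"
      then obtain n where n: "H n \<theta> x < r / 2"
        using height_eventually_less[of x \<theta> "r / 2"] r_pos by auto
      let ?w = "w (\<theta> + circle_of (real n * \<alpha>))" and ?f = "fiber_iter \<alpha> l n \<theta>"
      have "cmod (?f y) \<le> R" if "y \<in> ball z s" for y
        using that s(2) interior_subset unfolding filled_julia_fiber_le R_def by blast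
      then have "cmod (?f x - ?f z) \<le> 4 * R / s * dist z x"
        using x by (intro bounded_holomorphic_lipschitz fiber_iter_holomorphic s(1)) (auto simp: d_def)
      also have "\<dots> \<le> 4 * R / s * (r * s / (8 * R * M))"
        using x R s(1) by (intro mult_left_mono) (auto simp: d_def)
      also have "\<dots> = r / (2 * M)"
        using R s(1) M(1) by (simp add: field_simps)
      finally have diff: "cmod (?f x - ?f z) \<le> r / (2 * M)" .
      have "?w * cmod (?f x - ?f z) \<le> M * (r / (2 * M))"
        using diff M w_pos by (intro mult_mono) (auto intro: less_imp_le)
      then have "?w * cmod (?f x - ?f z) \<le> r / 2"
        using M(1) by simp
      moreover have "?w * cmod (?f z) \<le> ?w * cmod (?f x) + ?w * cmod (?f x - ?f z)"
        using norm_triangle_sub[of "?f z" "?f x"] w_pos[of "\<theta> + circle_of (real n * \<alpha>)"]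
        by (simp add: norm_minus_commute flip: distrib_left)
      ultimately have "H n \<theta> z < r"
        using n by (simp add: height_def)
      then show False using z basinI by blast
    qed
    moreover have "ball z d \<subseteq> ?U"
      using s(2) s(1) by (auto simp: d_def)
    ultimately show "\<exists>e>0. ball z e \<subseteq> ?U - B \<theta>"
      using d by blast
  qed
  then have "B \<theta> \<inter> ?U = {} \<or> (?U - B \<theta>) \<inter> ?U = {}"
    by (intro connectedD[OF conn open_basin]) auto
  then show ?thesis
    using sub zero_in_basin by blast
qed

text \<open>The basin is simply connected, being the interior of the filled-in fiber, and its quadratic preimage
  is the basin of the previous fiber, hence connected. So it contains the critical value, and the
  critical point belongs to the basin of the previous fiber, an open connected set.\<close>

lemma joined_of_connected_interiors:
  assumes conn: "\<And>\<theta>. connected (interior (K \<theta>))"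
  shows "\<exists>\<Gamma>. compact \<Gamma> \<and> connected \<Gamma> \<and> 0 \<in> \<Gamma> \<and> crit \<theta> \<in> \<Gamma> \<and> \<Gamma> \<subseteq> B \<theta>"
proof -
  let ?\<theta> = "\<theta> + circle_of \<alpha>" and ?a = "apply_bcontfun l \<theta>"
  have B: "B \<theta> = interior (K \<theta>)" for \<theta>
    by (rule basin_eq_interior_of_connected[OF conn])
  have "simply_connected (B ?\<theta>)"
    unfolding B by (rule simply_connected_interior_of_bounded_iterates
        [OF fiber_iter_holomorphic filled_julia_fiber_le conn])
  moreover have "{z. z\<^sup>2 + ?a * z \<in> B ?\<theta>} = B \<theta>"
    using fiber_quad_in_basin by (auto simp: fiber_quad_def)
  then have "connected {z. z\<^sup>2 + ?a * z \<in> B ?\<theta>}"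
    by (metis B conn)
  moreover have "B ?\<theta> \<noteq> {}" using zero_in_basin by blast
  ultimately have "- (?a / 2)\<^sup>2 \<in> B ?\<theta>"
    by (intro critical_value_in_simply_connected open_basin)
  moreover have "fiber_quad l \<theta> (crit \<theta>) = - (?a / 2)\<^sup>2"
    by (simp add: fiber_quad_def power2_eq_square)
  ultimately have "crit \<theta> \<in> B \<theta>"
    by (metis fiber_quad_in_basin)
  moreover have "path_connected (B \<theta>)"
    using connected_open_path_connected[OF open_basin] conn B by metis
  ultimately obtain g where g: "path g" "path_image g \<subseteq> B \<theta>" "pathstart g = 0" "pathfinish g = crit \<theta>"
    using zero_in_basin unfolding path_connected_def by blast
  then show ?thesis
    by (metis compact_path_image connected_path_image pathfinish_in_path_image pathstart_in_path_image)
qed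

end


section \<open>Openness of the domain\<close>

text \<open>The weight is the exponential of the transfer function that makes \<open>ln \<bar>l0\<bar>\<close> negative. The linear
  part then contracts at rate \<open>\<rho>\<close>. The perturbation and the quadratic term together may
  use up half of the gap between \<open>\<rho>\<close> and \<open>1\<close>.\<close>

lemma attracting_weight_nearby:
  assumes \<alpha>: "\<alpha> \<notin> \<rat>" and nz: "l0 \<in> nowhere_vanishing"
    and neg: "circle_integral (\<lambda>\<theta>. ln (cmod (apply_bcontfun l0 \<theta>))) < 0"
  obtains w \<kappa> r d where "d > 0" "\<And>l. dist l l0 < d \<Longrightarrow> attracting_weight \<alpha> l w \<kappa> r"
proof -
  have pos: "cmod (apply_bcontfun l0 \<theta>) > 0" for \<theta>
    using nz by (simp add: nowhere_vanishing_def)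
  have "continuous_on UNIV (\<lambda>\<theta>. ln (cmod (apply_bcontfun l0 \<theta>)))"
    using pos by (intro continuous_intros continuous_on_apply_bcontfun) (simp add: less_le)
  from coboundary_correction_negative[OF \<alpha> this neg]
  obtain u e where u: "continuous_on UNIV u" "e > 0"
    "\<And>\<theta>. ln (cmod (apply_bcontfun l0 \<theta>)) + u (\<theta> + circle_of \<alpha>) - u \<theta> \<le> - e"
    by blast
  define w where "w \<theta> = exp (u \<theta>)" for \<theta>
  define \<rho> where "\<rho> = exp (- e)"
  have \<rho>: "0 < \<rho>" "\<rho> < 1" using u(2) by (simp_all add: \<rho>_def)
  have w_cont: "continuous_on UNIV w"
    unfolding w_def by (intro continuous_intros u)
  have w_pos: "w \<theta> > 0" for \<theta> by (simp add: w_def)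
  have lin: "cmod (apply_bcontfun l0 \<theta>) * w (\<theta> + circle_of \<alpha>) \<le> \<rho> * w \<theta>" for \<theta>
  proof -
    have "cmod (apply_bcontfun l0 \<theta>) * w (\<theta> + circle_of \<alpha>)
        = exp (ln (cmod (apply_bcontfun l0 \<theta>)) + u (\<theta> + circle_of \<alpha>))"
      using pos by (simp add: w_def exp_add)
    also have "\<dots> \<le> exp (- e + u \<theta>)"
      using u(3)[of \<theta>] by simp
    finally show ?thesis by (simp only: w_def \<rho>_def exp_add)
  qed
  obtain a where a: "\<And>\<theta>. w a \<le> w \<theta>"
    using continuous_attains_inf[OF compact_UNIV_circle UNIV_not_empty w_cont] by auto
  obtain b where b: "\<And>\<theta>. w \<theta> \<le> w b"
    using continuous_attains_sup[OF compact_UNIV_circle UNIV_not_empty w_cont] by auto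
  \<comment> \<open>With \<open>w a\<close> the minimum and \<open>w b\<close> the maximum of the weight, \<open>d\<close> bounds both the
    perturbation of \<open>l0\<close> and the size of the points considered.\<close>
  define d where "d = (1 - \<rho>) / 2 * w a / (2 * w b)"
  have d: "d > 0" using \<rho> w_pos by (simp add: d_def)
  have dw: "2 * d * w b = (1 - \<rho>) / 2 * w a"
    using w_pos[of b] by (simp add: d_def)
  have "attracting_weight \<alpha> l w ((1 + \<rho>) / 2) (d * w a)" if l: "dist l l0 < d" for l
  proof
    fix \<theta> z assume z: "w \<theta> * cmod z \<le> d * w a"
    let ?w = "w (\<theta> + circle_of \<alpha>)"
    have "w a * cmod z \<le> w \<theta> * cmod z"
      using a by (intro mult_right_mono) auto
    then have "w a * cmod z \<le> w a * d" using z by (simp add: mult.commute)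
    then have zd: "cmod z \<le> d" using w_pos by simp
    have ld: "cmod (apply_bcontfun l \<theta>) \<le> cmod (apply_bcontfun l0 \<theta>) + d"
      using dist_bounded[of l \<theta> l0] l norm_triangle_sub[of "apply_bcontfun l \<theta>" "apply_bcontfun l0 \<theta>"]
      by (simp add: dist_norm)
    have "?w * cmod (z + apply_bcontfun l \<theta>) \<le> ?w * (cmod (apply_bcontfun l0 \<theta>) + 2 * d)"
      using zd ld norm_triangle_ineq[of z "apply_bcontfun l \<theta>"] w_pos less_imp_le
      by (intro mult_left_mono) auto
    also have "\<dots> = cmod (apply_bcontfun l0 \<theta>) * ?w + 2 * d * ?w"
      by (simp add: algebra_simps)
    also have "\<dots> \<le> \<rho> * w \<theta> + 2 * d * w b"
      using lin b d by (intro add_mono mult_left_mono) auto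
    also have "\<dots> \<le> \<rho> * w \<theta> + (1 - \<rho>) / 2 * w \<theta>"
      unfolding dw using a \<rho> by (intro add_left_mono mult_left_mono) auto
    also have "\<dots> = (1 + \<rho>) / 2 * w \<theta>"
      by (simp add: field_simps)
    finally have le: "?w * cmod (z + apply_bcontfun l \<theta>) \<le> (1 + \<rho>) / 2 * w \<theta>" .
    have "fiber_quad l \<theta> z = (z + apply_bcontfun l \<theta>) * z"
      by (simp add: fiber_quad_def power2_eq_square algebra_simps)
    then have "?w * cmod (fiber_quad l \<theta> z) = (?w * cmod (z + apply_bcontfun l \<theta>)) * cmod z"
      by (simp add: norm_mult)
    also have "\<dots> \<le> ((1 + \<rho>) / 2 * w \<theta>) * cmod z"
      by (intro mult_right_mono le) simp
    finally show "?w * cmod (fiber_quad l \<theta> z) \<le> (1 + \<rho>) / 2 * (w \<theta> * cmod z)"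
      by (simp add: mult.assoc)
  qed (use w_cont w_pos d \<rho> in auto)
  then show ?thesis using that d by blast
qed

text \<open>A compact set enters the region of attraction at one common time, and a strict inequality at one
  time on a compact set survives small changes of parameter and fiber. The set is enlarged by a
  disc around the critical point in order to catch the critical points of nearby maps.\<close>

lemma joined_nearby:
  assumes att: "attracting_weight \<alpha> l0 w \<kappa> r"
    and joined: "\<And>\<theta>. \<exists>\<Gamma>. compact \<Gamma> \<and> connected \<Gamma> \<and> 0 \<in> \<Gamma> \<and> - apply_bcontfun l0 \<theta> / 2 \<in> \<Gamma>
      \<and> \<Gamma> \<subseteq> basin \<alpha> l0 w r \<theta>"
  obtains X where "open X" "l0 \<in> X"
    "\<And>l \<theta>. l \<in> X \<Longrightarrow> \<exists>\<Gamma>. connected \<Gamma> \<and> 0 \<in> \<Gamma> \<and> - apply_bcontfun l \<theta> / 2 \<in> \<Gamma>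
      \<and> \<Gamma> \<subseteq> basin \<alpha> l w r \<theta>"
proof -
  interpret attracting_weight \<alpha> l0 w \<kappa> r by (rule att)
  define J where "J l \<theta> \<longleftrightarrow> (\<exists>\<Gamma>. connected \<Gamma> \<and> 0 \<in> \<Gamma> \<and> - apply_bcontfun l \<theta> / 2 \<in> \<Gamma>
      \<and> \<Gamma> \<subseteq> basin \<alpha> l w r \<theta>)" for l \<theta>
  define W where "W = \<Union>{V. open V \<and> (\<forall>(l, \<theta>) \<in> V. J l \<theta>)}"
  have "open W" unfolding W_def by (intro open_Union) auto
  have "(l0, \<theta>) \<in> W" for \<theta>
  proof -
    obtain \<Gamma> where \<Gamma>: "compact \<Gamma>" "connected \<Gamma>" "0 \<in> \<Gamma>" "crit \<theta> \<in> \<Gamma>" "\<Gamma> \<subseteq> B \<theta>"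
      using joined by blast
    define U where "U n = {z. H n \<theta> z < r}" for n
    have op: "open (U n)" for n
      unfolding U_def by (intro open_Collect_less continuous_intros w_cont)
    have cover: "\<Gamma> \<subseteq> (\<Union>n. U n)"
      using \<Gamma>(5) by (auto simp: U_def basin_def)
    obtain N where N: "finite N" "\<Gamma> \<subseteq> (\<Union>n\<in>N. U n)"
      by (rule compactE_image[OF \<Gamma>(1) op cover])
    define n where "n = Max N"
    have \<Gamma>U: "\<Gamma> \<subseteq> U n"
    proof
      fix z assume "z \<in> \<Gamma>"
      then obtain k where k: "k \<in> N" "H k \<theta> z < r" using N(2) by (auto simp: U_def)
      then show "z \<in> U n"
        using height_antimono[of k \<theta> z n] N(1) by (simp add: n_def U_def)
    qed
    then obtain s where s: "s > 0" "cball (crit \<theta>) s \<subseteq> U n"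
      using op \<Gamma>(4) open_contains_cball by blast
    define \<Gamma>' where "\<Gamma>' = \<Gamma> \<union> cball (crit \<theta>) s"
    have "compact \<Gamma>'" using \<Gamma>(1) by (simp add: \<Gamma>'_def compact_Un)
    have conn: "connected \<Gamma>'"
      unfolding \<Gamma>'_def using \<Gamma>(2,4) s(1) by (intro connected_Un) auto
    define G where "G = {x :: (circle_fun \<times> circle) \<times> complex.
      height \<alpha> (fst (fst x)) w n (snd (fst x)) (snd x) < r}"
    have "open G"
      unfolding G_def by (intro open_Collect_less continuous_intros w_cont)
    have "\<Gamma>' \<subseteq> U n"
      using \<Gamma>U s(2) by (simp add: \<Gamma>'_def)
    then have "{(l0, \<theta>)} \<times> \<Gamma>' \<subseteq> G"
      by (auto simp: G_def U_def)
    from Elementary_Topology.tube_lemma[OF \<open>compact \<Gamma>'\<close> \<open>open G\<close> this]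
    obtain V where V: "(l0, \<theta>) \<in> V" "open V" "V \<times> \<Gamma>' \<subseteq> G"
      by blast
    define V' where "V' = V \<inter> {x. dist (- apply_bcontfun (fst x) (snd x) / 2) (crit \<theta>) < s}"
    have "open V'"
      unfolding V'_def by (intro open_Int V open_Collect_less continuous_intros) auto
    moreover have "J l \<phi>" if "(l, \<phi>) \<in> V'" for l \<phi>
    proof -
      have "\<Gamma>' \<subseteq> basin \<alpha> l w r \<phi>"
        using V(3) that by (force simp: V'_def G_def basin_def)
      moreover have "- apply_bcontfun l \<phi> / 2 \<in> \<Gamma>'"
        using that by (simp add: V'_def \<Gamma>'_def dist_commute less_imp_le)
      ultimately show ?thesis
        unfolding J_def using conn \<Gamma>(3) by (intro exI[of _ \<Gamma>']) (auto simp: \<Gamma>'_def)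
    qed
    moreover have "(l0, \<theta>) \<in> V'"
      using V(1) s(1) by (simp add: V'_def)
    ultimately show ?thesis unfolding W_def by blast
  qed
  moreover have "J l \<theta>" if "(l, \<theta>) \<in> W" for l \<theta>
    using that by (auto simp: W_def)
  ultimately show ?thesis
    using that[OF open_all_circle[OF \<open>open W\<close>]] unfolding J_def by blast
qed

lemma open_nowhere_vanishing: "open nowhere_vanishing"
proof -
  have "open {x :: circle_fun \<times> circle. apply_bcontfun (fst x) (snd x) \<noteq> 0}"
    by (intro open_Collect_neq continuous_intros)
  from open_all_circle[OF this] show ?thesis
    by (simp add: nowhere_vanishing_def)
qed

lemma open_log_integral_negative:
  "open {l \<in> nowhere_vanishing. circle_integral (\<lambda>\<theta>. ln (cmod (apply_bcontfun l \<theta>))) < 0}"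
    (is "open ?S")
proof (subst open_subopen, safe)
  fix l0 assume nz: "l0 \<in> nowhere_vanishing"
    and neg: "circle_integral (\<lambda>\<theta>. ln (cmod (apply_bcontfun l0 \<theta>))) < 0"
  have cont: "continuous_on UNIV (\<lambda>\<theta>. ln (cmod (apply_bcontfun l \<theta>)))"
    if "l \<in> nowhere_vanishing" for l
    using that by (intro continuous_intros continuous_on_apply_bcontfun) (simp add: nowhere_vanishing_def)
  define e where "e = - circle_integral (\<lambda>\<theta>. ln (cmod (apply_bcontfun l0 \<theta>))) / 2"
  have e: "e > 0" using neg by (simp add: e_def)
  define X where "X = {l. \<forall>\<theta>. (l, \<theta>) \<in> {x. cmod (apply_bcontfun (fst x) (snd x))
      < exp e * cmod (apply_bcontfun l0 (snd x))}}"
  have "open X"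
    unfolding X_def by (intro open_all_circle open_Collect_less continuous_intros)
  moreover have "l0 \<in> X"
    using nz e by (simp add: X_def nowhere_vanishing_def)
  moreover have "circle_integral (\<lambda>\<theta>. ln (cmod (apply_bcontfun l \<theta>))) < 0"
    if "l \<in> X" "l \<in> nowhere_vanishing" for l
  proof -
    have "ln (cmod (apply_bcontfun l \<theta>)) \<le> e + ln (cmod (apply_bcontfun l0 \<theta>))" for \<theta>
    proof -
      have l: "0 < cmod (apply_bcontfun l \<theta>)" and l0: "0 < cmod (apply_bcontfun l0 \<theta>)"
        using that(2) nz by (simp_all add: nowhere_vanishing_def)
      have "ln (cmod (apply_bcontfun l \<theta>)) \<le> ln (exp e * cmod (apply_bcontfun l0 \<theta>))"
        using that(1) l by (intro ln_mono) (auto simp: X_def less_imp_le)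
      also have "\<dots> = e + ln (cmod (apply_bcontfun l0 \<theta>))"
        using l0 by (simp add: ln_mult)
      finally show ?thesis .
    qed
    then have "circle_integral (\<lambda>\<theta>. ln (cmod (apply_bcontfun l \<theta>)))
        \<le> circle_integral (\<lambda>\<theta>. e + ln (cmod (apply_bcontfun l0 \<theta>)))"
      by (intro circle_integral_le continuous_intros cont that nz)
    also have "\<dots> = e + circle_integral (\<lambda>\<theta>. ln (cmod (apply_bcontfun l0 \<theta>)))"
      by (subst circle_integral_add) (auto intro: cont nz)
    finally show ?thesis using e by (simp add: e_def)
  qed
  ultimately show "\<exists>T. open T \<and> l0 \<in> T \<and> T \<subseteq> ?S"
    using nz open_nowhere_vanishing by (intro exI[of _ "X \<inter> nowhere_vanishing"]) auto
qed

lemma winding_number_circle_nearby: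
  assumes nz: "l0 \<in> nowhere_vanishing"
  obtains X where "open X" "l0 \<in> X"
    "\<And>l. l \<in> X \<Longrightarrow> winding_number (\<lambda>t. apply_bcontfun l (circle_of t)) 0
      = winding_number (\<lambda>t. apply_bcontfun l0 (circle_of t)) 0"
proof -
  define X where "X = {l. \<forall>\<theta>. (l, \<theta>) \<in> {x. cmod (apply_bcontfun (fst x) (snd x) - apply_bcontfun l0 (snd x))
      < cmod (apply_bcontfun l0 (snd x))}}"
  have "open X"
    unfolding X_def by (intro open_all_circle open_Collect_less continuous_intros)
  moreover have "l0 \<in> X"
    using nz by (simp add: X_def nowhere_vanishing_def)
  moreover have "winding_number (\<lambda>t. apply_bcontfun l (circle_of t)) 0
      = winding_number (\<lambda>t. apply_bcontfun l0 (circle_of t)) 0" if "l \<in> X" for l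
  proof (rule winding_number_nearby_loops_eq)
    have path: "path (\<lambda>t. apply_bcontfun f (circle_of t))" for f :: circle_fun
      unfolding path_def by (rule continuous_on_circle_lift) simp
    have "circle_of 1 = circle_of 0" by (simp only: circle_of_eq_iff) simp
    then show "pathfinish (\<lambda>t. apply_bcontfun f (circle_of t)) = pathstart (\<lambda>t. apply_bcontfun f (circle_of t))"
      for f :: circle_fun by (simp add: pathfinish_def pathstart_def)
    then show "pathfinish (\<lambda>t. apply_bcontfun l (circle_of t)) = pathstart (\<lambda>t. apply_bcontfun l (circle_of t))"
      by blast
  qed (use that path_def in \<open>auto simp: X_def path_def intro!: continuous_on_circle_lift\<close>)
  ultimately show ?thesis using that by blast
qed

lemma open_H0_star:
  assumes \<alpha>: "\<alpha> \<notin> \<rat>"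
  shows "open (H0_star \<alpha>)"
proof (subst open_subopen, rule ballI)
  fix l0 assume l0: "l0 \<in> H0_star \<alpha>"
  have nz: "l0 \<in> nowhere_vanishing"
    using l0 by (simp add: H0_star_def)
  have card: "l0 \<in> main_cardioid \<alpha>"
    using l0 by (simp add: H0_star_def)
  have neg: "circle_integral (\<lambda>\<theta>. ln (cmod (apply_bcontfun l0 \<theta>))) < 0"
    using l0 by (simp add: H0_star_def)
  have wind: "winding_number (\<lambda>t. apply_bcontfun l0 (circle_of t)) 0 = 0"
    using l0 by (simp add: H0_star_def)
  have conn: "connected (interior (filled_julia_fiber \<alpha> l0 \<theta>))" for \<theta>
    using card by (simp add: main_cardioid_def)
  obtain w \<kappa> r d where d: "d > 0" "\<And>l. dist l l0 < d \<Longrightarrow> attracting_weight \<alpha> l w \<kappa> r"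
    by (rule attracting_weight_nearby[OF \<alpha> nz neg]) (rule that)
  then have att: "attracting_weight \<alpha> l0 w \<kappa> r" by simp
  obtain X where X: "open X" "l0 \<in> X"
    "\<And>l \<theta>. l \<in> X \<Longrightarrow> \<exists>\<Gamma>. connected \<Gamma> \<and> 0 \<in> \<Gamma> \<and> - apply_bcontfun l \<theta> / 2 \<in> \<Gamma>
      \<and> \<Gamma> \<subseteq> basin \<alpha> l w r \<theta>"
    by (rule joined_nearby[OF att attracting_weight.joined_of_connected_interiors[OF att conn]]) metis
  obtain Y where Y: "open Y" "l0 \<in> Y" "\<And>l. l \<in> Y \<Longrightarrow> winding_number (\<lambda>t. apply_bcontfun l (circle_of t)) 0 = 0"
    by (rule winding_number_circle_nearby[OF nz]) (simp add: wind)
  let ?T = "ball l0 d \<inter> X \<inter> Y \<inter>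
    {l \<in> nowhere_vanishing. circle_integral (\<lambda>\<theta>. ln (cmod (apply_bcontfun l \<theta>))) < 0}"
  have "l \<in> main_cardioid \<alpha>" if "l \<in> ball l0 d" "l \<in> X" for l
    using attracting_weight.main_cardioid_of_joined[OF d(2) X(3)] that by (simp add: dist_commute)
  then have "?T \<subseteq> H0_star \<alpha>"
    using Y(3) by (auto simp: H0_star_def)
  moreover have "open ?T"
    by (intro open_Int open_ball X Y open_log_integral_negative)
  moreover have "l0 \<in> ?T" using d(1) X Y nz neg by simp
  ultimately show "\<exists>T. open T \<and> l0 \<in> T \<and> T \<subseteq> H0_star \<alpha>" by blast
qed


section \<open>The multiplier map\<close>

lemma continuous_log_on_circle:
  assumes nz: "l \<in> nowhere_vanishing"
    and wind: "winding_number (\<lambda>t. apply_bcontfun l (circle_of t)) 0 = 0"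
  obtains g where "continuous_on UNIV g" "\<And>\<theta>. exp (g \<theta>) = apply_bcontfun l \<theta>"
proof -
  let ?p = "\<lambda>t. apply_bcontfun l (circle_of t)"
  have "path ?p"
    unfolding path_def by (rule continuous_on_circle_lift) simp
  moreover have "0 \<notin> path_image ?p"
    using nz by (auto simp: nowhere_vanishing_def path_image_def)
  ultimately obtain q where q: "path q" "pathfinish q - pathstart q = 2 * of_real pi * \<i> * winding_number ?p 0"
      "\<And>t. t \<in> {0..1} \<Longrightarrow> ?p t = 0 + exp (q t)"
    by (rule winding_number_as_continuous_log) (rule that)
  have "q 0 = q 1"
    using q(2) by (simp add: wind pathfinish_def pathstart_def)
  then obtain g where g: "continuous_on UNIV g" "\<And>t. t \<in> {0..1} \<Longrightarrow> g (circle_of t) = q t"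
    using continuous_on_circle_descend q(1) unfolding path_def by metis
  show ?thesis
  proof
    show "exp (g \<theta>) = apply_bcontfun l \<theta>" for \<theta>
    proof -
      obtain t where t: "t \<in> {0..<1}" "\<theta> = circle_of t"
        using circle_of_surj by blast
      then have "t \<in> {0..1}" by auto
      then show ?thesis using g(2) q(3) t(2) by simp
    qed
  qed (rule g)
qed

text \<open>The difference takes values in a discrete set and the circle is connected.\<close>

lemma continuous_logs_differ_by_constant:
  assumes "continuous_on UNIV g" "continuous_on UNIV h" "\<And>\<theta> :: circle. exp (g \<theta>) = exp (h \<theta> :: complex)"
  obtains c where "exp c = 1" "\<And>\<theta>. g \<theta> = h \<theta> + c"
proof -
  let ?d = "\<lambda>\<theta>. g \<theta> - h \<theta>"
  have one: "exp (?d \<theta>) = 1" for \<theta>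
    by (simp add: exp_diff assms(3))
  have "?d constant_on UNIV"
  proof (rule continuous_discrete_range_constant[OF connected_UNIV_circle])
    show "continuous_on UNIV ?d" by (intro continuous_intros assms)
    fix x
    have "2 * pi \<le> cmod (?d y - ?d x)" if "?d y \<noteq> ?d x" for y
    proof (rule ccontr)
      assume less: "\<not> ?thesis"
      have "exp (?d y) = exp (?d x)" by (simp only: one)
      moreover have "\<bar>Im (?d y) - Im (?d x)\<bar> < 2 * pi"
        using less abs_Im_le_cmod[of "?d y - ?d x"] by simp
      ultimately show False
        using that exp_complex_eqI by blast
    qed
    then show "\<exists>e>0. \<forall>y. y \<in> UNIV \<and> ?d y \<noteq> ?d x \<longrightarrow> e \<le> cmod (?d y - ?d x)"
      using pi_gt_zero by (intro exI[of _ "2 * pi"]) auto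
  qed
  then obtain c where "\<And>\<theta>. ?d \<theta> = c" by (auto simp: constant_on_def)
  then show ?thesis
    using that[of c] one by (metis add.commute diff_add_cancel)
qed

lemma fibered_multiplier_eq:
  assumes g: "continuous_on UNIV g" "\<And>\<theta>. exp (g \<theta>) = apply_bcontfun l \<theta>"
  shows "fibered_multiplier l = exp (circle_integral g)"
proof -
  have L: "continuous_on UNIV (log_branch l) \<and> (\<forall>\<theta>. exp (log_branch l \<theta>) = apply_bcontfun l \<theta>)"
    unfolding log_branch_def by (rule someI[of _ g]) (use g in auto)
  then obtain c where c: "exp c = 1" "\<And>\<theta>. log_branch l \<theta> = g \<theta> + c"
    using continuous_logs_differ_by_constant[of "log_branch l" g] g by metis
  have "log_branch l = (\<lambda>\<theta>. g \<theta> + c)" using c(2) by auto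
  then show ?thesis
    by (simp add: fibered_multiplier_def circle_integral_add g(1) exp_add c(1))
qed

lemma norm_fibered_multiplier:
  assumes g: "continuous_on UNIV g" "\<And>\<theta>. exp (g \<theta>) = apply_bcontfun l \<theta>"
  shows "cmod (fibered_multiplier l) = exp (circle_integral (\<lambda>\<theta>. ln (cmod (apply_bcontfun l \<theta>))))"
proof -
  have "ln (cmod (apply_bcontfun l \<theta>)) = Re (g \<theta>)" for \<theta>
    by (simp add: g(2)[symmetric])
  then show ?thesis
    by (simp add: fibered_multiplier_eq[OF g] circle_integral_Re g(1))
qed

lemma fibered_multiplier_in_punctured_disk:
  assumes l: "l \<in> H0_star \<alpha>"
  shows "fibered_multiplier l \<in> punctured_disk"
proof -
  have nz: "l \<in> nowhere_vanishing"
    using l by (simp add: H0_star_def)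
  have wind: "winding_number (\<lambda>t. apply_bcontfun l (circle_of t)) 0 = 0"
    using l by (simp add: H0_star_def)
  have neg: "circle_integral (\<lambda>\<theta>. ln (cmod (apply_bcontfun l \<theta>))) < 0"
    using l by (simp add: H0_star_def)
  obtain g where g: "continuous_on UNIV g" "\<And>\<theta>. exp (g \<theta>) = apply_bcontfun l \<theta>"
    by (rule continuous_log_on_circle[OF nz wind]) (rule that)
  show ?thesis
    using neg norm_fibered_multiplier[OF g] fibered_multiplier_eq[OF g] by (simp add: punctured_disk_def)
qed

lemma fibered_multiplier_scaleC:
  assumes g: "continuous_on UNIV g" "\<And>\<theta>. exp (g \<theta>) = apply_bcontfun l \<theta>" and c: "c \<noteq> 0"
  shows "fibered_multiplier (c *\<^sub>C l) = c * fibered_multiplier l"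
proof -
  have "fibered_multiplier (c *\<^sub>C l) = exp (circle_integral (\<lambda>\<theta>. Ln c + g \<theta>))"
    using c by (intro fibered_multiplier_eq continuous_intros g)
      (simp add: apply_bcontfun_scaleC scaleC_complex_def exp_add g(2))
  then show ?thesis
    using c by (simp add: circle_integral_add g(1) exp_add fibered_multiplier_eq[OF g])
qed

text \<open>The derivative at \<open>l\<close> of \<open>\<integral> log l\<close>.\<close>

definition log_derivative :: "circle_fun \<Rightarrow> circle_fun \<Rightarrow>\<^sub>L complex"
  where "log_derivative l = Blinfun (\<lambda>h. circle_integral (\<lambda>\<theta>. apply_bcontfun h \<theta> / apply_bcontfun l \<theta>))"

lemma nowhere_vanishing_lower_bound:
  assumes "l \<in> nowhere_vanishing"
  obtains m where "m > 0" "\<And>\<theta>. m \<le> cmod (apply_bcontfun l \<theta>)"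
proof -
  have "continuous_on UNIV (\<lambda>\<theta>. cmod (apply_bcontfun l \<theta>))"
    by (intro continuous_intros continuous_on_apply_bcontfun)
  then obtain a where "\<And>\<theta>. cmod (apply_bcontfun l a) \<le> cmod (apply_bcontfun l \<theta>)"
    using continuous_attains_inf[OF compact_UNIV_circle UNIV_not_empty] by auto
  then show ?thesis
    using that[of "cmod (apply_bcontfun l a)"] assms by (simp add: nowhere_vanishing_def)
qed

lemma log_derivative_apply:
  assumes l: "l \<in> nowhere_vanishing"
  shows "blinfun_apply (log_derivative l) h = circle_integral (\<lambda>\<theta>. apply_bcontfun h \<theta> / apply_bcontfun l \<theta>)"
proof -
  obtain m where m: "m > 0" "\<And>\<theta>. m \<le> cmod (apply_bcontfun l \<theta>)"
    using nowhere_vanishing_lower_bound[OF l] by blast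
  have cont: "continuous_on UNIV (\<lambda>\<theta>. apply_bcontfun h \<theta> / apply_bcontfun l \<theta>)" for h
    using l by (intro continuous_intros continuous_on_apply_bcontfun) (simp add: nowhere_vanishing_def)
  have "bounded_linear (\<lambda>h. circle_integral (\<lambda>\<theta>. apply_bcontfun h \<theta> / apply_bcontfun l \<theta>))"
  proof (rule bounded_linear_intro[of _ "1 / m"])
    fix h k :: circle_fun and c :: real
    show "circle_integral (\<lambda>\<theta>. apply_bcontfun (h + k) \<theta> / apply_bcontfun l \<theta>)
      = circle_integral (\<lambda>\<theta>. apply_bcontfun h \<theta> / apply_bcontfun l \<theta>)
      + circle_integral (\<lambda>\<theta>. apply_bcontfun k \<theta> / apply_bcontfun l \<theta>)"
      by (simp add: add_divide_distrib circle_integral_add cont)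
    show "circle_integral (\<lambda>\<theta>. apply_bcontfun (c *\<^sub>R h) \<theta> / apply_bcontfun l \<theta>)
      = c *\<^sub>R circle_integral (\<lambda>\<theta>. apply_bcontfun h \<theta> / apply_bcontfun l \<theta>)"
      using circle_integral_mult_left[of "of_real c" "\<lambda>\<theta>. apply_bcontfun h \<theta> / apply_bcontfun l \<theta>"]
      by (simp add: scaleR_conv_of_real)
    show "norm (circle_integral (\<lambda>\<theta>. apply_bcontfun h \<theta> / apply_bcontfun l \<theta>)) \<le> norm h * (1 / m)"
    proof (rule circle_integral_norm_le[OF cont])
      show "norm (apply_bcontfun h \<theta> / apply_bcontfun l \<theta>) \<le> norm h * (1 / m)" for \<theta>
        using frac_le[OF norm_ge_zero norm_bounded m(1) m(2), of h \<theta> \<theta>] by (simp add: norm_divide)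
    qed
  qed
  then show ?thesis
    by (simp add: log_derivative_def bounded_linear_Blinfun_apply)
qed

lemma continuous_on_log_derivative: "continuous_on nowhere_vanishing log_derivative"
  unfolding continuous_on_iff
proof (intro ballI allI impI)
  fix l0 :: circle_fun and e :: real assume l0: "l0 \<in> nowhere_vanishing" and e: "e > 0"
  obtain m where m: "m > 0" "\<And>\<theta>. m \<le> cmod (apply_bcontfun l0 \<theta>)"
    using nowhere_vanishing_lower_bound[OF l0] by blast
  define d where "d = min (m / 2) (e * m * m / 4)"
  have d: "d > 0" using m(1) e by (simp add: d_def)
  have "dist (log_derivative l) (log_derivative l0) < e"
    if l: "l \<in> nowhere_vanishing" "dist l l0 < d" for l
  proof -
    have diff: "cmod (apply_bcontfun l \<theta> - apply_bcontfun l0 \<theta>) \<le> d" for \<theta>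
      using dist_bounded[of l \<theta> l0] l(2) by (simp add: dist_norm)
    have low: "m / 2 \<le> cmod (apply_bcontfun l \<theta>)" for \<theta>
      using diff[of \<theta>] m(2)[of \<theta>] norm_triangle_sub[of "apply_bcontfun l0 \<theta>" "apply_bcontfun l \<theta>"]
      by (simp add: d_def norm_minus_commute)
    have nz: "apply_bcontfun l \<theta> \<noteq> 0" "apply_bcontfun l0 \<theta> \<noteq> 0" for \<theta>
      using l(1) l0 by (simp_all add: nowhere_vanishing_def)
    have cont: "continuous_on UNIV (\<lambda>\<theta>. apply_bcontfun h \<theta> / apply_bcontfun l \<theta>)"
        "continuous_on UNIV (\<lambda>\<theta>. apply_bcontfun h \<theta> / apply_bcontfun l0 \<theta>)" for h
      using nz by (auto intro!: continuous_intros continuous_on_apply_bcontfun)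
    have "norm (log_derivative l - log_derivative l0) \<le> e / 2"
    proof (rule norm_blinfun_bound)
      fix h :: circle_fun
      let ?k = "\<lambda>\<theta>. apply_bcontfun h \<theta> / apply_bcontfun l \<theta> - apply_bcontfun h \<theta> / apply_bcontfun l0 \<theta>"
      have "blinfun_apply (log_derivative l - log_derivative l0) h = circle_integral ?k"
        by (simp only: blinfun.diff_left log_derivative_apply[OF l(1)] log_derivative_apply[OF l0]
            circle_integral_diff[OF cont])
      also have "norm \<dots> \<le> e / 2 * norm h"
      proof (rule circle_integral_norm_le)
        show "continuous_on UNIV ?k" by (intro continuous_intros cont)
        fix \<theta>
        have "?k \<theta> = apply_bcontfun h \<theta> * (apply_bcontfun l0 \<theta> - apply_bcontfun l \<theta>)
            / (apply_bcontfun l \<theta> * apply_bcontfun l0 \<theta>)"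
          using nz[of \<theta>] by (simp add: field_simps)
        then have "norm (?k \<theta>) = cmod (apply_bcontfun h \<theta>) * cmod (apply_bcontfun l \<theta> - apply_bcontfun l0 \<theta>)
            / (cmod (apply_bcontfun l \<theta>) * cmod (apply_bcontfun l0 \<theta>))"
          by (simp add: norm_mult norm_divide norm_minus_commute)
        also have "\<dots> \<le> norm h * (e * m * m / 4) / (m / 2 * m)"
        proof (rule frac_le)
          show "cmod (apply_bcontfun h \<theta>) * cmod (apply_bcontfun l \<theta> - apply_bcontfun l0 \<theta>) \<le> norm h * (e * m * m / 4)"
            using diff[of \<theta>] by (intro mult_mono norm_bounded) (auto simp: d_def)
          show "m / 2 * m \<le> cmod (apply_bcontfun l \<theta>) * cmod (apply_bcontfun l0 \<theta>)"
            using m low by (intro mult_mono) auto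
        qed (use m e in auto)
        also have "\<dots> = e / 2 * norm h"
          using m(1) by (simp add: field_simps)
        finally show "norm (?k \<theta>) \<le> e / 2 * norm h" .
      qed
      finally show "norm (blinfun_apply (log_derivative l - log_derivative l0) h) \<le> e / 2 * norm h" .
    qed (use e in simp)
    then show ?thesis using e by (simp add: dist_norm)
  qed
  then show "\<exists>d>0. \<forall>l\<in>nowhere_vanishing. dist l l0 < d \<longrightarrow> dist (log_derivative l) (log_derivative l0) < e"
    using d by blast
qed

text \<open>Near \<open>l0\<close>, the multiplier is \<open>fibered_multiplier l0 * exp (\<integral> Ln (1 + x))\<close> with the relative
  perturbation \<open>x = (l - l0) / l0\<close>, and \<open>Ln (1 + x) - x\<close> is quadratic in \<open>x\<close>.\<close>

lemma fibered_multiplier_has_derivative: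
  assumes nz: "l0 \<in> nowhere_vanishing"
    and g: "continuous_on UNIV g" "\<And>\<theta>. exp (g \<theta>) = apply_bcontfun l0 \<theta>"
  shows "(fibered_multiplier has_derivative
    (\<lambda>h. fibered_multiplier l0 * blinfun_apply (log_derivative l0) h)) (at l0)"
proof -
  obtain m where m: "m > 0" "\<And>\<theta>. m \<le> cmod (apply_bcontfun l0 \<theta>)"
    using nowhere_vanishing_lower_bound[OF nz] by blast
  have l0_nz: "apply_bcontfun l0 \<theta> \<noteq> 0" for \<theta>
    using nz by (simp add: nowhere_vanishing_def)
  define x where "x l \<theta> = apply_bcontfun (l - l0) \<theta> / apply_bcontfun l0 \<theta>" for l \<theta>
  have x_le: "cmod (x l \<theta>) \<le> norm (l - l0) / m" for l \<theta>
    unfolding x_def norm_divide by (intro frac_le norm_ge_zero norm_bounded m)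
  have x_cont: "continuous_on UNIV (x l)" for l
    unfolding x_def using l0_nz by (intro continuous_intros continuous_on_apply_bcontfun) auto
  have x_small: "cmod (x l \<theta>) < 1/2" if "norm (l - l0) < m / 2" for l \<theta>
  proof -
    have "norm (l - l0) / m < 1/2" using that m(1) by (simp add: field_simps)
    then show ?thesis using x_le[of l \<theta>] by linarith
  qed
  define G where "G l = circle_integral (\<lambda>\<theta>. Ln (1 + x l \<theta>))" for l
  have Ln_dom: "1 + z \<notin> \<real>\<^sub>\<le>\<^sub>0" if "cmod z < 1/2" for z :: complex
  proof
    assume "1 + z \<in> \<real>\<^sub>\<le>\<^sub>0"
    then have "Re (1 + z) \<le> 0" by (simp add: complex_nonpos_Reals_iff)
    then show False using that abs_Re_le_cmod[of z] by simp
  qed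
  have Ln_cont: "continuous_on UNIV (\<lambda>\<theta>. Ln (1 + x l \<theta>))" if "norm (l - l0) < m / 2" for l
    using Ln_dom x_small[OF that] by (intro continuous_intros x_cont) auto
  have near_l0: "fibered_multiplier l = fibered_multiplier l0 * exp (G l)" if l: "l \<in> ball l0 (m / 2)" for l
  proof -
    have l': "norm (l - l0) < m / 2" using l by (simp add: dist_norm norm_minus_commute)
    have "exp (g \<theta> + Ln (1 + x l \<theta>)) = apply_bcontfun l \<theta>" for \<theta>
    proof -
      have "1 + x l \<theta> \<noteq> 0" using Ln_dom[OF x_small[OF l'], of \<theta>] by auto
      then show ?thesis
        using l0_nz[of \<theta>] by (simp add: exp_add g(2) x_def field_simps)
    qed
    then have "fibered_multiplier l = exp (circle_integral (\<lambda>\<theta>. g \<theta> + Ln (1 + x l \<theta>)))"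
      by (intro fibered_multiplier_eq continuous_on_add g Ln_cont l')
    then show ?thesis
      using circle_integral_add[OF g(1) Ln_cont[OF l']]
      by (simp add: exp_add fibered_multiplier_eq[OF g] G_def)
  qed
  have G_l0: "G l0 = 0" by (simp add: G_def x_def)
  have "(G has_derivative blinfun_apply (log_derivative l0)) (at l0)"
    unfolding has_derivative_at_alt
  proof (intro conjI allI impI)
    show "bounded_linear (blinfun_apply (log_derivative l0))"
      by (rule blinfun.bounded_linear_right)
    fix e :: real assume e: "e > 0"
    define d where "d = min (m / 2) (e * m * m / 2)"
    have d: "d > 0" using m(1) e by (simp add: d_def)
    have "norm (G l - G l0 - blinfun_apply (log_derivative l0) (l - l0)) \<le> e * norm (l - l0)"
      if l: "norm (l - l0) < d" for l
    proof -
      have l': "norm (l - l0) < m / 2" using l by (simp add: d_def)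
      have "G l - G l0 - blinfun_apply (log_derivative l0) (l - l0)
          = circle_integral (\<lambda>\<theta>. Ln (1 + x l \<theta>) - x l \<theta>)"
        using circle_integral_diff[OF Ln_cont[OF l'] x_cont]
        by (simp only: G_l0 diff_0_right) (simp only: G_def log_derivative_apply[OF nz] x_def[symmetric])
      also have "norm \<dots> \<le> e * norm (l - l0)"
      proof (rule circle_integral_norm_le)
        show "continuous_on UNIV (\<lambda>\<theta>. Ln (1 + x l \<theta>) - x l \<theta>)"
          by (intro continuous_on_diff Ln_cont l' x_cont)
        fix \<theta>
        have sm: "cmod (x l \<theta>) < 1/2" by (rule x_small[OF l'])
        then have "cmod (Ln (1 + x l \<theta>) - x l \<theta>) \<le> (cmod (x l \<theta>))\<^sup>2 / (1 - cmod (x l \<theta>))"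
          by (intro Ln_approx_linear) simp
        also have "\<dots> \<le> (norm (l - l0) / m)\<^sup>2 / (1/2)"
          using sm x_le[of l \<theta>] by (intro frac_le power_mono) auto
        also have "\<dots> = norm (l - l0) * (2 * norm (l - l0) / (m * m))"
          by (simp add: power2_eq_square)
        also have "\<dots> \<le> norm (l - l0) * e"
          using l m(1) by (intro mult_left_mono) (auto simp: d_def field_simps)
        finally show "cmod (Ln (1 + x l \<theta>) - x l \<theta>) \<le> e * norm (l - l0)"
          by (simp add: mult.commute)
      qed
      finally show ?thesis .
    qed
    then show "\<exists>d>0. \<forall>l. norm (l - l0) < d \<longrightarrow>
        norm (G l - G l0 - blinfun_apply (log_derivative l0) (l - l0)) \<le> e * norm (l - l0)"
      using d by blast
  qed
  from has_derivative_compose[OF this DERIV_exp[unfolded has_field_derivative_def]]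
  have "((\<lambda>l. exp (G l)) has_derivative blinfun_apply (log_derivative l0)) (at l0)"
    by (simp add: G_l0)
  then have "((\<lambda>l. fibered_multiplier l0 * exp (G l)) has_derivative
      (\<lambda>h. fibered_multiplier l0 * blinfun_apply (log_derivative l0) h)) (at l0)"
    by (rule has_derivative_mult_right)
  then show ?thesis
  proof (rule has_derivative_transform_within_open)
    show "l0 \<in> ball l0 (m / 2)" using m(1) by simp
    show "fibered_multiplier l0 * exp (G l) = fibered_multiplier l" if "l \<in> ball l0 (m / 2)" for l
      by (rule near_l0[OF that, symmetric])
  qed simp
qed

lemma log_branch_of_H0_star:
  assumes "l \<in> H0_star \<alpha>"
  obtains g where "continuous_on UNIV g" "\<And>\<theta>. exp (g \<theta>) = apply_bcontfun l \<theta>"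
  by (rule continuous_log_on_circle[of l]) (use assms in \<open>auto simp: H0_star_def\<close>)

lemma holomorphic_map_fibered_multiplier:
  assumes op: "open (H0_star \<alpha>)"
  shows "holomorphic_map fibered_multiplier (H0_star \<alpha>) punctured_disk"
proof -
  define D where "D l = blinfun_mult_right (fibered_multiplier l) o\<^sub>L log_derivative l" for l
  have sub: "H0_star \<alpha> \<subseteq> nowhere_vanishing"
    by (auto simp: H0_star_def)
  have der: "(fibered_multiplier has_derivative blinfun_apply (D l)) (at l)" if l: "l \<in> H0_star \<alpha>" for l
  proof -
    obtain g where "continuous_on UNIV g" "\<And>\<theta>. exp (g \<theta>) = apply_bcontfun l \<theta>"
      by (rule log_branch_of_H0_star[OF l]) (rule that)
    from fibered_multiplier_has_derivative[OF _ this] l sub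
    have "(fibered_multiplier has_derivative
        (\<lambda>h. fibered_multiplier l * blinfun_apply (log_derivative l) h)) (at l)" by blast
    moreover have "blinfun_apply (D l) = (\<lambda>h. fibered_multiplier l * blinfun_apply (log_derivative l) h)"
      by (auto simp: D_def)
    ultimately show ?thesis by simp
  qed
  have "continuous_on (H0_star \<alpha>) fibered_multiplier"
    using der has_derivative_continuous continuous_at_imp_continuous_on by blast
  then have "continuous_on (H0_star \<alpha>) (\<lambda>l. blinfun_mult_right (fibered_multiplier l))"
    by (rule bounded_linear.continuous_on[OF bounded_linear_blinfun_mult_right])
  then have "continuous_on (H0_star \<alpha>) D"
    unfolding D_def
    by (intro bounded_bilinear.continuous_on[OF bounded_bilinear_blinfun_compose]
        continuous_on_subset[OF continuous_on_log_derivative sub])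
  moreover have "blinfun_apply (D l) (c *\<^sub>C v) = c *\<^sub>C blinfun_apply (D l) v" if l: "l \<in> H0_star \<alpha>" for l c v
  proof -
    have nz: "l \<in> nowhere_vanishing" using l sub by blast
    have "blinfun_apply (log_derivative l) (c *\<^sub>C v) = c * blinfun_apply (log_derivative l) v"
      by (simp add: log_derivative_apply[OF nz] apply_bcontfun_scaleC scaleC_complex_def
          circle_integral_mult_left flip: times_divide_eq_right)
    then show ?thesis by (simp add: D_def scaleC_complex_def)
  qed
  moreover have "open punctured_disk"
    by (simp add: punctured_disk_def open_delete)
  ultimately show ?thesis
    unfolding holomorphic_map_def using op der fibered_multiplier_in_punctured_disk
    by (intro conjI exI[of _ D] ballI) auto
qed

text \<open>Multiplying a parameter by a constant multiplies its multiplier by this constant.\<close>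

lemma fibered_multiplier_local_section:
  assumes op: "open (H0_star \<alpha>)" and l: "l \<in> H0_star \<alpha>"
  shows "\<exists>V s. open V \<and> fibered_multiplier l \<in> V \<and> V \<subseteq> punctured_disk \<and>
    holomorphic_map s V (H0_star \<alpha>) \<and> s (fibered_multiplier l) = l \<and>
    (\<forall>y\<in>V. fibered_multiplier (s y) = y)"
proof -
  let ?F = "fibered_multiplier"
  obtain g where g: "continuous_on UNIV g" "\<And>\<theta>. exp (g \<theta>) = apply_bcontfun l \<theta>"
    by (rule log_branch_of_H0_star[OF l]) (rule that)
  have Fl: "?F l \<in> punctured_disk" by (rule fibered_multiplier_in_punctured_disk[OF l])
  then have nz: "?F l \<noteq> 0" by (simp add: punctured_disk_def)
  define s where "s y = (y / ?F l) *\<^sub>C l" for y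
  have bl: "bounded_linear s"
  proof (rule bounded_linear_intro[of _ "norm l / cmod (?F l)"])
    show "s (x + y) = s x + s y" for x y
      by (simp add: s_def add_divide_distrib scaleC_add_left)
    show "s (r *\<^sub>R x) = r *\<^sub>R s x" for r x
      by (simp add: s_def scaleR_conv_of_real scaleC_scaleC flip: scaleC_of_real)
    show "norm (s x) \<le> norm x * (norm l / cmod (?F l))" for x
      by (simp add: s_def norm_scaleC norm_divide)
  qed
  have one: "s (?F l) = l"
    using nz scaleC_of_real[of 1 l] by (simp add: s_def)
  define V where "V = punctured_disk \<inter> s -` H0_star \<alpha>"
  have "open V"
    unfolding V_def
    by (intro open_Int open_vimage op linear_continuous_on bl) (simp add: punctured_disk_def open_delete)
  moreover have "holomorphic_map s V (H0_star \<alpha>)"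
    unfolding holomorphic_map_def
  proof (intro conjI exI[of _ "\<lambda>_. Blinfun s"] ballI allI)
    show "(s has_derivative blinfun_apply (Blinfun s)) (at x)" for x
      by (simp add: bounded_linear_Blinfun_apply[OF bl] bounded_linear_imp_has_derivative[OF bl])
    show "blinfun_apply (Blinfun s) (c *\<^sub>C v) = c *\<^sub>C blinfun_apply (Blinfun s) v" for c v
      by (simp add: bounded_linear_Blinfun_apply[OF bl] s_def scaleC_complex_def scaleC_scaleC)
  qed (use \<open>open V\<close> op in \<open>auto simp: V_def\<close>)
  moreover have "?F (s y) = y" if "y \<in> V" for y
  proof -
    have "y / ?F l \<noteq> 0" using that nz by (simp add: V_def punctured_disk_def)
    from fibered_multiplier_scaleC[OF g this] show ?thesis
      using nz by (simp add: s_def)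
  qed
  ultimately show ?thesis
    using one Fl l by (intro exI[of _ V] exI[of _ s]) (auto simp: V_def)
qed

theorem theoremB:
  fixes \<alpha> :: real
  assumes "diophantine \<alpha>"
  shows "holomorphic_submersion fibered_multiplier (H0_star \<alpha>) punctured_disk"
proof -
  have "\<alpha> \<notin> \<rat>"
    using assms by (simp add: diophantine_def)
  then have "open (H0_star \<alpha>)"
    by (rule open_H0_star)
  then show ?thesis
    unfolding holomorphic_submersion_def
    using holomorphic_map_fibered_multiplier fibered_multiplier_local_section by blast
qed

end
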